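(* Let $n$ be a positive integer, let $A \in M_n$, and let $k$ be a positive integer such that $k < n/3 + 1$. Then the rank-$k$ numerical range $\Lambda_k(A)$ is non-empty.
   Context: $M_n$ denotes the algebra of $n \times n$ complex matrices. For $A \in M_n$ and a positive integer $k$, the rank-$k$ numerical range of $A$ is $$\Lambda_k(A) = \{\lambda \in \mathbb{C} : X^*AX = \lambda I_k \text{ for some } n \times k \text{ complex matrix } X \text{ with } X^*X = I_k\},$$ where $X^*$ is the conjugate transpose of $X$ and $I_k$ is the $k \times k$ identity matrix. *)

theory Defs
  imports "Jordan_Normal_Form.Schur_Decomposition"
begin

definition rank_numerical_range :: "nat \<Rightarrow> complex mat \<Rightarrow> complex set" where
  "rank_numerical_range k A =
    {\<mu>. \<exists>X \<in> carrier_mat (dim_row A) k.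
       mat_adjoint X * X = 1\<^sub>m k \<and> mat_adjoint X * A * X = \<mu> \<cdot>\<^sub>m 1\<^sub>m k}"

end

theory Submission
  imports
    Defs
    "Jordan_Normal_Form.Spectral_Radius"
    "HOL-Analysis.Convex"
    "HOL-Analysis.Elementary_Topology"
    "HOL-Library.Function_Algebras"
begin

text \<open>
  A scalar \<open>\<mu>\<close> lies in the rank-\<open>k\<close> numerical range of \<open>A\<close> if and only if the sesquilinear form
  \<open>b(x, y) = x\<^sup>* A y - \<mu> x\<^sup>* y\<close> vanishes identically on some \<open>k\<close>-dimensional subspace, that is, if this
  subspace is isotropic for the Hermitian and the skew-Hermitian part of \<open>b\<close> at once.  For a unit
  complex number \<open>\<omega>\<close> let \<open>H\<^sub>\<omega>\<close> be the Hermitian part of \<open>\<omega> b\<close>.  An isotropic subspace of dimension \<open>k\<close>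
  meets every subspace on which \<open>H\<^sub>\<omega>\<close> is negative definite trivially, so it forces the negative index
  of \<open>H\<^sub>\<omega>\<close> to be at most \<open>n - k\<close>.  The proof rests on the converse, \<open>isotropic_subspace_exists\<close>:
  if this index condition holds for all but finitely many \<open>\<omega>\<close>, then an isotropic subspace of
  dimension \<open>k\<close> exists.

  Given the converse, only \<open>\<mu>\<close> has to be found (\<open>scalar_compression_exists\<close>).  By the Courant-Fischer
  principle the index condition says that \<open>\<mu>\<close> lies in the half-plane \<open>Re (\<omega> \<mu>) \<le> c \<omega>\<close>, where \<open>c \<omega>\<close> is
  the \<open>k\<close>-th largest eigenvalue of the Hermitian part of \<open>\<omega> A\<close>.  Any three of these half-planes have a
  common point: each of the three Hermitian parts is bounded by its \<open>c \<omega>\<close> on a subspace of codimension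
  \<open>k - 1\<close>, and since \<open>3 (k - 1) < n\<close> three such subspaces share a unit vector \<open>x\<close>; then \<open>x\<^sup>* A x\<close> is in
  all three half-planes.  Helly's theorem in the plane and compactness give a point common to all of them.

  The converse is proved by induction on the dimension.  Over the complex numbers there is always a
  pencil eigenvector, a vector \<open>u \<noteq> 0\<close> for which the two functionals \<open>b(u, y)\<close> and \<open>cnj (b(y, u))\<close> of
  \<open>y\<close> are linearly dependent; hence their common kernel \<open>W\<close> has codimension at most one.  If such a \<open>u\<close>
  can be chosen with \<open>b(u, u) = 0\<close>, then \<open>u \<in> W\<close>, and passing to \<open>W\<close> modulo \<open>u\<close> lowers \<open>k\<close> by one and
  keeps the index condition (\<open>isotropic_reduction\<close>); \<open>u\<close> is added to the isotropic subspace found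
  there.  Otherwise pencil eigenvectors can be split off one after the other, and they form an
  orthogonal basis (\<open>orthogonal_basis_exists\<close>).

  In the remaining diagonal case let \<open>d u = b(u, u)\<close> for the basis vectors \<open>u\<close>.  No two of these complex
  numbers point in opposite directions, as otherwise a combination of the two basis vectors would be
  an isotropic pencil eigenvector.  Rotate the plane so that the right half-plane contains as few of
  the \<open>d u\<close> as possible, say \<open>q \<ge> k\<close>.  Minimality says that the slopes of the \<open>d u\<close> on the right
  interlace those of the \<open>d u\<close> on the left (\<open>minimal_halfplane_interlacing\<close>), and by the converse of
  Cauchy's interlacing theorem (\<open>interlacing_isometry\<close>) the diagonal matrix of the right slopes is a
  compression of that of the left slopes.  The graph of the isometry realising the compression is,
  after rescaling the coordinates, an isotropic subspace of dimension \<open>q\<close>.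
\<close>

section \<open>Linear functionals on finite spans\<close>

locale complex_vector_space = vector_space scale
  for scale :: "complex \<Rightarrow> 'v::ab_group_add \<Rightarrow> 'v" (infixr "\<star>" 75)
begin

definition functional :: "('v \<Rightarrow> complex) \<Rightarrow> bool" where
  "functional \<phi> \<longleftrightarrow> (\<forall>x y. \<phi> (x + y) = \<phi> x + \<phi> y) \<and> (\<forall>c x. \<phi> (c \<star> x) = c * \<phi> x)"

lemma functionalD:
  assumes "functional \<phi>"
  shows "\<phi> (x + y) = \<phi> x + \<phi> y" "\<phi> (c \<star> x) = c * \<phi> x" "\<phi> 0 = 0"
proof -
  show *: "\<phi> (x + y) = \<phi> x + \<phi> y" "\<phi> (c \<star> x) = c * \<phi> x" for x y c
    using assms by (auto simp: functional_def)
  show "\<phi> 0 = 0" using *(2)[of 0 0] by simp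
qed

lemma functional_diff:
  assumes "functional \<phi>" shows "\<phi> (x - y) = \<phi> x - \<phi> y"
  using functionalD(1)[OF assms, of "x - y" y] by simp

lemma functional_sum:
  assumes "functional \<phi>"
  shows "\<phi> (\<Sum>i\<in>I. c i \<star> f i) = (\<Sum>i\<in>I. c i * \<phi> (f i))"
  by (induction I rule: infinite_finite_induct) (simp_all add: functionalD[OF assms])

lemma subspace_kernel:
  assumes "functional \<phi>" shows "subspace {x \<in> span B. \<phi> x = 0}"
  unfolding subspace_def
  by (auto simp: functionalD[OF assms] span_zero span_add span_scale)

lemma kernel_on_span:
  assumes "functional \<phi>" "\<And>x. x \<in> S \<Longrightarrow> \<phi> x = 0" "y \<in> span S"
  shows "\<phi> y = 0"
proof -
  have "subspace {x. \<phi> x = 0}"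
    unfolding subspace_def by (auto simp: functionalD[OF assms(1)])
  then have "span S \<subseteq> {x. \<phi> x = 0}" using assms(2) by (intro span_minimal) auto
  then show ?thesis using assms(3) by auto
qed

text \<open>
  The spaces considered here are finite-dimensional subspaces of a possibly infinite-dimensional one,
  so dimensions are expressed as cardinalities of finite bases.
\<close>
lemma card_eq_of_span_eq:
  assumes "finite B" "independent B" "finite C" "independent C" "span B = span C"
  shows "card B = card C"
  using independent_span_bound[OF assms(1,4)] independent_span_bound[OF assms(3,2)] assms(5)
  by (metis le_antisym span_superset)

lemma span_insert_cong:
  assumes "span S = span T" shows "span (insert x S) = span (insert x T)"
  unfolding span_insert assms ..

text \<open>
  The prescribed part \<open>E\<close> of the basis is needed to divide the kernel by a vector \<open>u\<close> later: then \<open>E = {u}\<close>,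
  and \<open>D - {u}\<close> spans a complement of \<open>u\<close>.
\<close>
lemma kernel_basis:
  assumes B: "finite B" "independent B" and phi: "functional \<phi>"
    and E: "independent E" "E \<subseteq> {x \<in> span B. \<phi> x = 0}"
  obtains D where "finite D" "independent D" "E \<subseteq> D" "span D = {x \<in> span B. \<phi> x = 0}"
proof -
  obtain D where D: "E \<subseteq> D" "D \<subseteq> {x \<in> span B. \<phi> x = 0}" "independent D"
     "{x \<in> span B. \<phi> x = 0} \<subseteq> span D"
    using maximal_independent_subset_extend[OF E(2,1)] by blast
  have "finite D" using independent_span_bound[OF B(1) D(3)] D(2) by auto
  moreover have "span D \<subseteq> {x \<in> span B. \<phi> x = 0}"
    using span_minimal[OF D(2) subspace_kernel[OF phi]] .
  ultimately show thesis using that[of D] D by auto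
qed

lemma basis_insert_kernel:
  assumes B: "finite B" "independent B" and phi: "functional \<phi>"
    and D: "finite D" "independent D" "span D = {x \<in> span B. \<phi> x = 0}"
    and b: "b \<in> span B" "\<phi> b \<noteq> 0"
  shows "independent (insert b D)" "span (insert b D) = span B" "card B = Suc (card D)"
proof -
  have nb: "b \<notin> span D" using D(3) b by auto
  then have nbD: "b \<notin> D" using span_base by auto
  show ind: "independent (insert b D)" using independent_insertI[OF nb D(2)] .
  have "D \<subseteq> span B" using D(3) span_superset[of D] by auto
  then have "span (insert b D) \<subseteq> span B"
    by (intro span_minimal) (auto simp: b)
  moreover have "y \<in> span (insert b D)" if y: "y \<in> span B" for y
  proof -
    have "y - (\<phi> y / \<phi> b) \<star> b \<in> span D"
      unfolding D(3) using y b by (auto simp: functional_diff[OF phi] functionalD[OF phi] span_diff span_scale)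
    then show ?thesis unfolding span_insert by blast
  qed
  ultimately show sp: "span (insert b D) = span B" by auto
  show "card B = Suc (card D)"
    using card_eq_of_span_eq[OF B _ ind] sp D(1) nbD by simp
qed

text \<open>
  A homogeneous linear system with fewer equations than unknowns has a nontrivial solution: every
  equation cuts the dimension down by at most one.  All dimension counts for intersections of
  subspaces below are instances of this.
\<close>
lemma common_zero:
  assumes "finite \<Phi>" "\<And>\<phi>. \<phi> \<in> \<Phi> \<Longrightarrow> functional \<phi>"
    and "finite B" "independent B" "card \<Phi> < card B"
  shows "\<exists>x \<in> span B. x \<noteq> 0 \<and> (\<forall>\<phi>\<in>\<Phi>. \<phi> x = 0)"
  using assms
proof (induction \<Phi> arbitrary: B rule: finite_induct)
  case empty
  then obtain b where b: "b \<in> B" by fastforce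
  then have "b \<noteq> 0" using empty dependent_zero by blast
  then show ?case using b span_base by auto
next
  case (insert \<phi> \<Phi>)
  have phi: "functional \<phi>" using insert by auto
  obtain D where D: "finite D" "independent D" "span D = {x \<in> span B. \<phi> x = 0}"
    by (rule kernel_basis[OF insert.prems(2,3) phi independent_empty empty_subsetI])
  have "card B \<le> Suc (card D)"
  proof (cases "\<exists>b\<in>span B. \<phi> b \<noteq> 0")
    case True
    then show ?thesis using basis_insert_kernel(3)[OF insert.prems(2,3) phi D] by auto
  next
    case False
    then have "span D = span B" using D(3) by auto
    then show ?thesis using card_eq_of_span_eq[OF insert.prems(2,3) D(1,2)] by simp
  qed
  then have "card \<Phi> < card D" using insert by simp
  then obtain x where "x \<in> span D" "x \<noteq> 0" "\<forall>\<psi>\<in>\<Phi>. \<psi> x = 0"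
    using insert.IH[OF _ D(1,2)] insert.prems by blast
  then show ?case using D(3) by auto
qed

lemma independent_dual:
  assumes "finite I" "\<And>i. i \<in> I \<Longrightarrow> functional (\<psi> i)"
    and diag: "\<And>i. i \<in> I \<Longrightarrow> \<psi> i (x i) \<noteq> 0"
    and off: "\<And>i j. i \<in> I \<Longrightarrow> j \<in> I \<Longrightarrow> i \<noteq> j \<Longrightarrow> \<psi> i (x j) = 0"
  shows "inj_on x I" "independent (x ` I)"
proof -
  show inj: "inj_on x I" using diag off by (metis inj_onI)
  show "independent (x ` I)"
  proof (rule independent_if_scalars_zero)
    show "finite (x ` I)" using assms by auto
    fix f v assume s: "(\<Sum>v\<in>x ` I. f v \<star> v) = 0" and v: "v \<in> x ` I"
    then obtain i where i: "i \<in> I" "v = x i" by auto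
    have "0 = \<psi> i (\<Sum>v\<in>x ` I. f v \<star> v)" using s functionalD(3)[OF assms(2)[OF i(1)]] by simp
    also have "\<dots> = \<psi> i (\<Sum>j\<in>I. f (x j) \<star> x j)" using sum.reindex[OF inj, of "\<lambda>v. f v \<star> v"] by (simp add: o_def)
    also have "\<dots> = (\<Sum>j\<in>I. f (x j) * \<psi> i (x j))" by (rule functional_sum[OF assms(2)[OF i(1)]])
    also have "\<dots> = (\<Sum>j\<in>I. if j = i then f (x i) * \<psi> i (x i) else 0)"
      using off[OF i(1)] by (intro sum.cong) auto
    also have "\<dots> = f v * \<psi> i v" using i assms(1) by simp
    finally show "f v = 0" using diag i by auto
  qed
qed

end

section \<open>Sesquilinear forms and their pencil eigenvectors\<close>

locale sesquilinear_form = complex_vector_space scale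
  for scale :: "complex \<Rightarrow> 'v::ab_group_add \<Rightarrow> 'v" (infixr "\<star>" 75) +
  fixes a :: "'v \<Rightarrow> 'v \<Rightarrow> complex"
  assumes add_left: "a (x + y) z = a x z + a y z"
    and add_right: "a z (x + y) = a z x + a z y"
    and scale_left: "a (c \<star> x) y = cnj c * a x y"
    and scale_right: "a x (c \<star> y) = c * a x y"
begin

lemma functional_right: "functional (a x)"
  by (simp add: functional_def add_right scale_right)

lemma functional_left: "functional (\<lambda>y. cnj (a y x))"
  by (simp add: functional_def add_left scale_left)

lemma zero_left [simp]: "a 0 x = 0"
  using scale_left[of 0 0 x] by simp

lemma zero_right [simp]: "a x 0 = 0"
  using functionalD(3)[OF functional_right] .

lemma sum_right: "a x (\<Sum>i\<in>I. c i \<star> f i) = (\<Sum>i\<in>I. c i * a x (f i))"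
  by (rule functional_sum[OF functional_right])

lemma sum_left: "a (\<Sum>i\<in>I. c i \<star> f i) x = (\<Sum>i\<in>I. cnj (c i) * a (f i) x)"
proof -
  have "cnj (a (\<Sum>i\<in>I. c i \<star> f i) x) = (\<Sum>i\<in>I. c i * cnj (a (f i) x))"
    by (rule functional_sum[OF functional_left])
  then have "cnj (cnj (a (\<Sum>i\<in>I. c i \<star> f i) x)) = cnj (\<Sum>i\<in>I. c i * cnj (a (f i) x))" by (rule arg_cong)
  then show ?thesis by simp
qed

text \<open>
  In terms of a matrix \<open>M\<close> of the form, the equation reads \<open>\<alpha> M u + \<beta> M\<^sup>* u = 0\<close>.  Equivalently \<open>u\<close> is in
  the kernel of a member of the complex pencil spanned by the Hermitian and the skew-Hermitian part.
  Homogeneous coordinates \<open>(\<alpha>, \<beta>)\<close> include the eigenvalue at infinity.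
\<close>
definition pencil_eigenvector :: "'v set \<Rightarrow> 'v \<Rightarrow> bool" where
  "pencil_eigenvector V u \<longleftrightarrow> u \<in> V \<and> u \<noteq> 0 \<and>
     (\<exists>\<alpha> \<beta>. (\<alpha>, \<beta>) \<noteq> (0, 0) \<and> (\<forall>y\<in>V. \<alpha> * a y u + \<beta> * cnj (a u y) = 0))"

text \<open>
  This is what pencil eigenvectors are good for: orthogonality to \<open>u\<close> from both sides, which amounts to
  two linear conditions in general, is a single one.
\<close>
lemma pencil_eigenvector_annihilator:
  assumes "pencil_eigenvector V u"
  obtains \<phi> where "functional \<phi>" "\<And>y. y \<in> V \<Longrightarrow> \<phi> y = 0 \<longleftrightarrow> a u y = 0 \<and> a y u = 0"
proof -
  obtain \<alpha> \<beta> where ab: "(\<alpha>, \<beta>) \<noteq> (0, 0)" "\<And>y. y \<in> V \<Longrightarrow> \<alpha> * a y u + \<beta> * cnj (a u y) = 0"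
    using assms unfolding pencil_eigenvector_def by blast
  show thesis
  proof (cases "\<alpha> = 0")
    case True
    then have "a u y = 0" if "y \<in> V" for y using ab(1) ab(2)[OF that] by auto
    then show thesis using that[OF functional_left[of u]] by auto
  next
    case False
    have "a u y = 0 \<Longrightarrow> a y u = 0" if "y \<in> V" for y
      using ab(2)[OF that] False by auto
    then show thesis using that[OF functional_right[of u]] by blast
  qed
qed

text \<open>
  A pencil eigenvector \<open>u\<close> with \<open>a u u \<noteq> 0\<close> is not orthogonal to itself, so its annihilator is a
  hyperplane complementary to \<open>u\<close>.  Pairing a vector \<open>w\<close> of that hyperplane with \<open>u\<close> gives zero, hence
  the equation that makes \<open>w\<close> a pencil eigenvector of the hyperplane extends to the whole space.
\<close>
lemma orthogonal_basis_insert: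
  assumes B: "finite B" "independent B" and u: "pencil_eigenvector (span B) u" "a u u \<noteq> 0"
  obtains D where "finite D" "independent D" "card B = Suc (card D)" "span (insert u D) = span B"
    "independent (insert u D)"
    "\<And>y. y \<in> span D \<Longrightarrow> a u y = 0 \<and> a y u = 0"
    "\<And>w. pencil_eigenvector (span D) w \<Longrightarrow> pencil_eigenvector (span B) w"
proof -
  obtain \<phi> where phi: "functional \<phi>" "\<And>y. y \<in> span B \<Longrightarrow> \<phi> y = 0 \<longleftrightarrow> a u y = 0 \<and> a y u = 0"
    using pencil_eigenvector_annihilator[OF u(1)] by blast
  have uB: "u \<in> span B" "\<phi> u \<noteq> 0" using u phi(2)[of u] by (auto simp: pencil_eigenvector_def)
  obtain D where D: "finite D" "independent D" "span D = {x \<in> span B. \<phi> x = 0}"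
    by (rule kernel_basis[OF B phi(1) independent_empty empty_subsetI])
  note ins = basis_insert_kernel[OF B phi(1) D uB]
  have orth: "a u y = 0 \<and> a y u = 0" if "y \<in> span D" for y
    using that D(3) phi(2) by auto
  have pe: "pencil_eigenvector (span B) w" if w: "pencil_eigenvector (span D) w" for w
  proof -
    obtain \<alpha> \<beta> where ab: "(\<alpha>, \<beta>) \<noteq> (0, 0)" "\<And>y. y \<in> span D \<Longrightarrow> \<alpha> * a y w + \<beta> * cnj (a w y) = 0"
      and wD: "w \<in> span D" "w \<noteq> 0"
      using w unfolding pencil_eigenvector_def by blast
    have "\<alpha> * a y w + \<beta> * cnj (a w y) = 0" if y: "y \<in> span B" for y
    proof -
      obtain c where c: "y - c \<star> u \<in> span D" using y unfolding ins(2)[symmetric] span_insert by blast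
      have "y = (y - c \<star> u) + c \<star> u" by simp
      then have "a y w = a (y - c \<star> u) w" "a w y = a w (y - c \<star> u)"
        using orth[OF wD(1)] by (metis add_left add.right_neutral mult_zero_right scale_left,
              metis add_right add.right_neutral mult_zero_right scale_right)
      then show ?thesis using ab(2)[OF c] by simp
    qed
    then show ?thesis using ab(1) wD D(3) unfolding pencil_eigenvector_def by blast
  qed
  show thesis using that[OF D(1,2) ins(3,2,1) orth pe] .
qed

text \<open>
  With \<open>M1\<close> the Gram matrix of a basis and \<open>M2\<close> its conjugate transpose, either \<open>M2\<close> is singular and a kernel
  vector of it works, or \<open>M2\<close> is invertible and an eigenvector of the product of its inverse with \<open>M1\<close> works.
\<close>
lemma pencil_eigenvector_exists:
  assumes B: "finite B" "independent B" "B \<noteq> {}"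
  shows "\<exists>u. pencil_eigenvector (span B) u"
proof -
  obtain bs where bs: "set bs = B" "distinct bs" using finite_distinct_list[OF B(1)] by blast
  define n where "n = length bs"
  have n0: "n \<noteq> 0" using bs(1) B(3) by (auto simp: n_def)
  define M1 where "M1 = mat n n (\<lambda>(i,j). a (bs ! i) (bs ! j))"
  \<comment> \<open>Entries conjugated so that both products are linear in the coefficient vector.\<close>
  define M2 where "M2 = mat n n (\<lambda>(i,j). cnj (a (bs ! j) (bs ! i)))"
  have M [simp]: "M1 \<in> carrier_mat n n" "M2 \<in> carrier_mat n n" by (auto simp: M1_def M2_def)
  define cmb where "cmb v = (\<Sum>j<n. (v $ j) \<star> (bs ! j))" for v
  have e1: "(M1 *\<^sub>v v) $ i = a (bs ! i) (cmb v)" if "v \<in> carrier_vec n" "i < n" for v i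
    using that unfolding cmb_def sum_right
    by (simp add: M1_def scalar_prod_def lessThan_atLeast0 mult.commute)
  have e2: "(M2 *\<^sub>v v) $ i = cnj (a (cmb v) (bs ! i))" if "v \<in> carrier_vec n" "i < n" for v i
    using that unfolding cmb_def sum_left
    by (simp add: M2_def scalar_prod_def lessThan_atLeast0 mult.commute)
  have pe: "pencil_eigenvector (span B) (cmb v)"
    if v: "v \<in> carrier_vec n" "v \<noteq> 0\<^sub>v n" and ab: "(\<alpha>, \<beta>) \<noteq> (0, 0)"
      and z: "\<And>i. i < n \<Longrightarrow> \<alpha> * (M1 *\<^sub>v v) $ i + \<beta> * (M2 *\<^sub>v v) $ i = 0" for v \<alpha> \<beta>
  proof -
    have "cmb v \<noteq> 0"
    proof
      assume c0: "cmb v = 0"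
      have inj: "inj_on ((!) bs) {..<n}" using bs(2) by (auto simp: n_def inj_on_nth)
      have "v $ i = 0" if i: "i < n" for i
      proof -
        define f where "f x = v $ (the_inv_into {..<n} ((!) bs) x)" for x
        have f: "f (bs ! j) = v $ j" if "j < n" for j
          using that by (simp add: f_def the_inv_into_f_f[OF inj])
        have B': "B = (!) bs ` {..<n}" using bs(1) by (auto simp: n_def set_conv_nth)
        have "(\<Sum>x\<in>B. f x \<star> x) = cmb v"
          unfolding B' cmb_def sum.reindex[OF inj] by (simp add: f)
        then have "f (bs ! i) = 0"
          using B c0 i B' dependent_finite[OF B(1)] by auto
        then show ?thesis using f i by simp
      qed
      then show False using v by (auto intro!: eq_vecI)
    qed
    moreover have "cmb v \<in> span B"
      unfolding cmb_def using bs(1) by (intro span_sum span_scale span_base) (auto simp: n_def)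
    moreover have "\<alpha> * a y (cmb v) + \<beta> * cnj (a (cmb v) y) = 0" if y: "y \<in> span B" for y
    proof -
      have "functional (\<lambda>y. cnj \<alpha> * cnj (a y (cmb v)) + cnj \<beta> * a (cmb v) y)"
        by (simp add: functional_def add_left add_right scale_left scale_right algebra_simps)
      moreover have "cnj \<alpha> * cnj (a x (cmb v)) + cnj \<beta> * a (cmb v) x = 0" if x: "x \<in> B" for x
      proof -
        obtain i where i: "i < n" "x = bs ! i" using x bs(1) by (auto simp: n_def in_set_conv_nth)
        have "cnj (\<alpha> * a x (cmb v) + \<beta> * cnj (a (cmb v) x)) = 0"
          using z[OF i(1)] e1[OF v(1) i(1)] e2[OF v(1) i(1)] i(2) by simp
        then show ?thesis by simp
      qed
      ultimately have "cnj \<alpha> * cnj (a y (cmb v)) + cnj \<beta> * a (cmb v) y = 0"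
        using kernel_on_span y by blast
      then have "cnj (cnj \<alpha> * cnj (a y (cmb v)) + cnj \<beta> * a (cmb v) y) = 0" by (simp only: complex_cnj_zero)
      then show ?thesis by simp
    qed
    ultimately show ?thesis unfolding pencil_eigenvector_def using ab by blast
  qed
  show ?thesis
  proof (cases "det M2 = 0")
    case True
    then obtain v where "v \<in> carrier_vec n" "v \<noteq> 0\<^sub>v n" "M2 *\<^sub>v v = 0\<^sub>v n"
      using det_0_iff_vec_prod_zero[OF M(2)] by blast
    then show ?thesis using pe[of v 0 1] by auto
  next
    case False
    then obtain M3 where M3: "M3 \<in> carrier_mat n n" "M2 * M3 = 1\<^sub>m n"
      using det_non_zero_imp_unit[OF M(2) False, of "()"] unfolding Units_def ring_mat_def by auto
    have "spectrum (M3 * M1) \<noteq> {}" using M3 n0 by (intro spectrum_non_empty[of _ n]) auto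
    then obtain c v where v: "eigenvector (M3 * M1) v c"
      unfolding spectrum_def eigenvalue_def by auto
    then have v': "v \<in> carrier_vec n" "v \<noteq> 0\<^sub>v n" "(M3 * M1) *\<^sub>v v = c \<cdot>\<^sub>v v"
      using M3 unfolding eigenvector_def by auto
    have "M2 *\<^sub>v (c \<cdot>\<^sub>v v) = (M2 * M3 * M1) *\<^sub>v v"
      using v'(1) M3(1) unfolding v'(3)[symmetric]
      by (simp add: assoc_mult_mat_vec[of _ n n _ n] assoc_mult_mat[of _ n n _ n _ n])
    then have "c \<cdot>\<^sub>v (M2 *\<^sub>v v) = M1 *\<^sub>v v"
      using v'(1) unfolding M3(2) left_mult_one_mat[OF M(1)] by (simp add: mult_mat_vec[of _ n n])
    then have "(M1 *\<^sub>v v) $ i = c * (M2 *\<^sub>v v) $ i" if "i < n" for i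
      using that v'(1) by (metis M(2) dim_mult_mat_vec carrier_matD(1) index_smult_vec(1))
    then show ?thesis using pe[OF v'(1,2), of 1 "-c"] by auto
  qed
qed

text \<open>
  The spectral theorem for a Hermitian matrix and the Gram-Schmidt process are also instances of this
  lemma: for a positive definite form, and for a form whose imaginary part is positive definite, no
  vector besides \<open>0\<close> is isotropic.
\<close>
lemma orthogonal_basis_exists:
  assumes "finite B" "independent B"
    and "\<And>u. pencil_eigenvector (span B) u \<Longrightarrow> a u u \<noteq> 0"
  shows "\<exists>U. finite U \<and> independent U \<and> span U = span B \<and> card U = card B \<and>
    (\<forall>u\<in>U. \<forall>v\<in>U. u \<noteq> v \<longrightarrow> a u v = 0) \<and> (\<forall>u\<in>U. a u u \<noteq> 0)"
  using assms
proof (induction "card B" arbitrary: B)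
  case 0
  then show ?case by (intro exI[of _ "{}"]) auto
next
  case (Suc n)
  then have "B \<noteq> {}" by auto
  then obtain u where u: "pencil_eigenvector (span B) u"
    using pencil_eigenvector_exists Suc.prems by blast
  have auu: "a u u \<noteq> 0" using Suc.prems(3)[OF u] .
  obtain D where D: "finite D" "independent D" "card B = Suc (card D)" "span (insert u D) = span B"
    "independent (insert u D)"
    "\<And>y. y \<in> span D \<Longrightarrow> a u y = 0 \<and> a y u = 0"
    "\<And>w. pencil_eigenvector (span D) w \<Longrightarrow> pencil_eigenvector (span B) w"
    using orthogonal_basis_insert[OF Suc.prems(1,2) u auu] by blast
  have "n = card D" using D(3) Suc.hyps(2) by simp
  then have "\<exists>U. finite U \<and> independent U \<and> span U = span D \<and> card U = card D \<and>
      (\<forall>u\<in>U. \<forall>v\<in>U. u \<noteq> v \<longrightarrow> a u v = 0) \<and> (\<forall>u\<in>U. a u u \<noteq> 0)"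
    using D(1,2,7) Suc.prems(3) by (intro Suc.hyps(1)) auto
  then obtain U where U0: "finite U \<and> independent U \<and> span U = span D \<and> card U = card D \<and>
      (\<forall>u\<in>U. \<forall>v\<in>U. u \<noteq> v \<longrightarrow> a u v = 0) \<and> (\<forall>u\<in>U. a u u \<noteq> 0)" ..
  then have U: "finite U" "independent U" "span U = span D" "card U = card D"
    "\<And>v w. v \<in> U \<Longrightarrow> w \<in> U \<Longrightarrow> v \<noteq> w \<Longrightarrow> a v w = 0" "\<And>v. v \<in> U \<Longrightarrow> a v v \<noteq> 0"
    by auto
  have orth: "a u v = 0 \<and> a v u = 0" if "v \<in> U" for v
    using D(6)[of v] that U(3) span_base by blast
  have uU: "u \<notin> span U" using D(6)[of u] auu U(3) by auto
  have uU': "u \<notin> U" using uU span_base by blast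
  show ?case
  proof (intro exI[of _ "insert u U"] conjI)
    show "independent (insert u U)" using independent_insertI[OF uU U(2)] .
    show "span (insert u U) = span B" using span_insert_cong[OF U(3)] D(4) by simp
    show "card (insert u U) = card B" using uU' U D by simp
  qed (use U orth auu in auto)
qed

lemma orthogonal_expansion:
  assumes "finite U" "\<And>u v. u \<in> U \<Longrightarrow> v \<in> U \<Longrightarrow> u \<noteq> v \<Longrightarrow> a u v = 0" "\<And>u. u \<in> U \<Longrightarrow> a u u \<noteq> 0"
    and x: "x \<in> span U"
  shows "x = (\<Sum>u\<in>U. (a u x / a u u) \<star> u)"
proof -
  obtain c where c: "x = (\<Sum>u\<in>U. c u \<star> u)" using x span_finite[OF assms(1)] by auto
  have coeff: "a u x = c u * a u u" if u: "u \<in> U" for u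
  proof -
    have "a u x = (\<Sum>v\<in>U. c v * a u v)" unfolding c by (rule sum_right)
    also have "\<dots> = (\<Sum>v\<in>U. if v = u then c u * a u u else 0)"
      using assms(2)[OF u] by (intro sum.cong) auto
    finally show ?thesis using assms(1) u by simp
  qed
  have "(\<Sum>u\<in>U. (a u x / a u u) \<star> u) = (\<Sum>u\<in>U. c u \<star> u)"
    by (intro sum.cong refl) (simp add: coeff assms(3))
  then show ?thesis using c by simp
qed

lemma orthogonal_norm:
  assumes U: "finite U" "\<And>u v. u \<in> U \<Longrightarrow> v \<in> U \<Longrightarrow> u \<noteq> v \<Longrightarrow> a u v = 0"
  shows "a (\<Sum>u\<in>U. c u \<star> u) (\<Sum>u\<in>U. c u \<star> u) = (\<Sum>u\<in>U. of_real ((cmod (c u))\<^sup>2) * a u u)"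
proof -
  have "a (\<Sum>u\<in>U. c u \<star> u) (\<Sum>u\<in>U. c u \<star> u) = (\<Sum>u\<in>U. \<Sum>v\<in>U. cnj (c u) * (c v * a u v))"
    unfolding sum_left by (simp only: sum_right sum_distrib_left)
  also have "\<dots> = (\<Sum>u\<in>U. \<Sum>v\<in>U. if v = u then cnj (c u) * (c u * a u u) else 0)"
    by (intro sum.cong refl) (use U(2) in auto)
  also have "\<dots> = (\<Sum>u\<in>U. cnj (c u) * (c u * a u u))" using U(1) by simp
  finally show ?thesis by (simp add: complex_norm_square mult_ac del: of_real_power)
qed

end

section \<open>Splitting off an isotropic pencil eigenvector\<close>

text \<open>
  For a unit number \<open>\<omega>\<close>, multiplying the equation by \<open>\<omega>\<close> turns it into \<open>\<omega>\<^sup>2 p = - cnj q\<close>, which has at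
  most two solutions.
\<close>
lemma finite_singular_directions:
  fixes p q :: complex
  assumes "p \<noteq> 0 \<or> q \<noteq> 0"
  shows "finite {\<omega>. cmod \<omega> = 1 \<and> \<omega> * p + cnj (\<omega> * q) = 0}" (is "finite ?S")
proof (cases "?S = {}")
  case True
  show ?thesis unfolding True by simp
next
  case False
  then obtain \<omega>0 where w0: "\<omega>0 \<in> ?S" by blast
  have sq: "\<omega>\<^sup>2 * p = - cnj q" if "\<omega> \<in> ?S" for \<omega>
  proof -
    have e: "\<omega> * cnj \<omega> = 1" using that by (simp add: complex_norm_square[symmetric])
    have "\<omega> * (\<omega> * p + cnj (\<omega> * q)) = 0" using that by simp
    then have "\<omega>\<^sup>2 * p + (\<omega> * cnj \<omega>) * cnj q = 0" by (simp add: algebra_simps power2_eq_square)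
    then show ?thesis by (simp add: e add_eq_0_iff2)
  qed
  have p0: "p \<noteq> 0" using sq[OF w0] assms by auto
  have "?S \<subseteq> {\<omega>0, - \<omega>0}"
  proof
    fix \<omega> assume "\<omega> \<in> ?S"
    then have "\<omega>\<^sup>2 * p = \<omega>0\<^sup>2 * p" using sq w0 by auto
    then have "\<omega>\<^sup>2 = \<omega>0\<^sup>2" using p0 by simp
    then show "\<omega> \<in> {\<omega>0, - \<omega>0}" by (auto simp: power2_eq_iff)
  qed
  then show ?thesis by (rule finite_subset) simp
qed

context sesquilinear_form
begin

definition negative_on :: "complex \<Rightarrow> 'v set \<Rightarrow> bool" where
  "negative_on \<omega> V \<longleftrightarrow> (\<forall>x\<in>V. x \<noteq> 0 \<longrightarrow> Re (\<omega> * a x x) < 0)"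

text \<open>
  If \<open>B\<close> is a basis, this bounds the negative index of the Hermitian part of \<open>\<omega> a\<close> by \<open>card B - k\<close>.
  Since \<open>\<omega>\<close> may be replaced by \<open>- \<omega>\<close>, the positive index is bounded as well.  The finite exceptional set
  \<open>F\<close> absorbs the directions in which a split-off pencil eigenvector lies in the radical of
  the Hermitian part.
\<close>
definition generic_depth :: "'v set \<Rightarrow> nat \<Rightarrow> bool" where
  "generic_depth B k \<longleftrightarrow> (\<exists>F. finite F \<and> (\<forall>\<omega>. cmod \<omega> = 1 \<longrightarrow> \<omega> \<notin> F \<longrightarrow>
     (\<forall>N. finite N \<longrightarrow> independent N \<longrightarrow> N \<subseteq> span B \<longrightarrow> negative_on \<omega> (span N) \<longrightarrow> card N + k \<le> card B)))"

text \<open>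
  Let \<open>h\<close> be the Hermitian form belonging to \<open>Re (\<omega> a x x)\<close>.  The vector \<open>u\<close> is \<open>h\<close>-isotropic and
  \<open>h\<close>-orthogonal to \<open>N\<close>, but not to \<open>b\<close>.  Therefore the span of \<open>u\<close> and of the projection of \<open>b\<close> to the
  orthogonal complement of \<open>N\<close> is a hyperbolic plane, which contains a negative vector.
\<close>
lemma negative_extension:
  assumes N: "finite N" "independent N" "negative_on \<omega> (span N)"
    and u: "a u u = 0" "\<And>x. x \<in> span N \<Longrightarrow> a u x = 0 \<and> a x u = 0"
    and b: "\<omega> * a b u + cnj (\<omega> * a u b) \<noteq> 0"
  shows "\<exists>y \<in> span (insert b (insert u N)). y \<notin> span N \<and> negative_on \<omega> (span (insert y N))"
proof -
  define h where "h x y = \<omega> * a x y + cnj (\<omega> * a y x)" for x y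
  define F where "F x = Re (\<omega> * a x x)" for x
  have hr: "functional (h x)" for x
    unfolding functional_def h_def by (simp add: add_left add_right scale_left scale_right algebra_simps)
  have hsym: "h y x = cnj (h x y)" for x y by (simp add: h_def)
  have Fadd: "F (x + y) = F x + F y + Re (h x y)" for x y
    by (simp add: F_def h_def add_left add_right algebra_simps)
  have Fscale: "F (c \<star> x) = (cmod c)\<^sup>2 * F x" for c x
  proof -
    have "\<omega> * a (c \<star> x) (c \<star> x) = of_real ((cmod c)\<^sup>2) * (\<omega> * a x x)"
      by (simp add: scale_left scale_right complex_norm_square mult_ac del: of_real_power)
    then show ?thesis unfolding F_def by (simp only: times_complex.sel Re_complex_of_real Im_complex_of_real mult_zero_left diff_zero)
  qed
  have Fneg: "F x < 0" if "x \<in> span N" "x \<noteq> 0" for x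
    using N(3) that by (auto simp: negative_on_def F_def)
  have Nu: "h x u = 0" if "x \<in> span N" for x using u(2)[OF that] by (simp add: h_def)
  have bu: "h b u \<noteq> 0" using b by (simp add: h_def)
  have nb: "b \<notin> span N" using bu Nu by blast
  have bN: "b \<notin> N" using nb span_base by blast
  \<comment> \<open>A nonzero multiple of the projection of \<open>b\<close> to the \<open>h\<close>-orthogonal complement of \<open>N\<close>, obtained by counting equations.\<close>
  obtain z where z: "z \<in> span (insert b N)" "z \<noteq> 0" "\<And>n. n \<in> N \<Longrightarrow> h n z = 0"
  proof -
    have "card (h ` N) < card (insert b N)" using card_image_le[OF N(1), of h] bN N(1) by simp
    then show thesis
      using common_zero[of "h ` N" "insert b N"] N hr independent_insertI[OF nb N(2)] that by auto
  qed
  have hz: "h x z = 0" if "x \<in> span N" for x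
  proof -
    have "h z x = 0" using kernel_on_span[OF hr _ that, of z] z(3) hsym by (metis complex_cnj_zero)
    then show ?thesis using hsym by (metis complex_cnj_zero)
  qed
  obtain s where s: "z - s \<star> b \<in> span N" using z(1) unfolding span_insert by blast
  have s0: "s \<noteq> 0"
  proof
    assume "s = 0"
    then have "z \<in> span N" using s by simp
    then have "F z < 0" "h z z = 0" using Fneg z(2) hz by auto
    then show False by (simp add: h_def F_def complex_eq_iff)
  qed
  have hzu: "h z u \<noteq> 0"
  proof -
    have "h u (z - s \<star> b) = 0" using Nu[OF s] hsym by (metis complex_cnj_zero)
    then have "h u z = s * h u b" by (simp add: functional_diff[OF hr] functionalD[OF hr])
    then show ?thesis using s0 bu hsym by (metis complex_cnj_zero_iff mult_eq_0_iff)
  qed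
  \<comment> \<open>Adding a multiple of \<open>u\<close> changes \<open>F z\<close> by an arbitrary real number.\<close>
  define c where "c = - of_real (\<bar>F z\<bar> + 1) / h z u"
  define y where "y = z + c \<star> u"
  have "F u = 0" by (simp add: F_def u(1))
  then have "F y = F z + Re (c * h z u)"
    by (simp add: y_def Fadd Fscale functionalD[OF hr])
  also have "c * h z u = - of_real (\<bar>F z\<bar> + 1)" using hzu by (simp add: c_def)
  finally have Fy: "F y < 0" by simp
  have hy: "h x y = 0" if "x \<in> span N" for x
    using that hz Nu by (simp add: y_def functionalD[OF hr])
  have "h u u = 0" by (simp add: h_def u(1))
  then have "h u y \<noteq> 0" using hzu hsym by (metis y_def functionalD(1,2)[OF hr] add.right_neutral complex_cnj_zero mult_zero_right)
  then have yN: "y \<notin> span N" using Nu hsym by (metis complex_cnj_zero)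
  have "F x < 0" if x: "x \<in> span (insert y N)" "x \<noteq> 0" for x
  proof -
    obtain t where t: "x - t \<star> y \<in> span N" using x(1) unfolding span_insert by blast
    have "F x = F ((x - t \<star> y) + t \<star> y)" by simp
    also have "\<dots> = F (x - t \<star> y) + (cmod t)\<^sup>2 * F y"
      unfolding Fadd Fscale using hy[OF t] by (simp add: functionalD[OF hr])
    finally have e: "F x = F (x - t \<star> y) + (cmod t)\<^sup>2 * F y" .
    show ?thesis
    proof (cases "t = 0")
      case True
      then show ?thesis using t x(2) Fneg by simp
    next
      case False
      have "F (x - t \<star> y) \<le> 0"
        using Fneg[OF t] by (cases "x - t \<star> y = 0") (auto simp: F_def)
      moreover have "(cmod t)\<^sup>2 * F y < 0" using False Fy by (simp add: mult_pos_neg)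
      ultimately show ?thesis using e by simp
    qed
  qed
  then have "negative_on \<omega> (span (insert y N))" by (simp add: negative_on_def F_def)
  moreover have "y \<in> span (insert b (insert u N))"
  proof -
    have "z \<in> span (insert b (insert u N))" using z(1) span_mono[of "insert b N" "insert b (insert u N)"] by auto
    then show ?thesis unfolding y_def by (intro span_add span_scale) (auto intro: span_base)
  qed
  ultimately show ?thesis using yN by blast
qed

text \<open>
  The span of \<open>C\<close> is a model of \<open>W\<close> modulo \<open>u\<close>, where \<open>W\<close> is the annihilator of \<open>u\<close>.  If \<open>W\<close> is the whole
  space, the dimension drops by one and negative definite subspaces persist.  Otherwise it drops by
  two, but then, for all but finitely many \<open>\<omega>\<close>, every negative definite subspace of the span of \<open>C\<close> can
  be enlarged by one dimension inside the span of \<open>B\<close>.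
\<close>
lemma isotropic_reduction:
  assumes B: "finite B" "independent B" and u: "pencil_eigenvector (span B) u" "a u u = 0"
    and depth: "generic_depth B (Suc k)"
  obtains C where "finite C" "independent (insert u C)" "u \<notin> C" "span (insert u C) \<subseteq> span B"
    "card C < card B" "\<And>y. y \<in> span (insert u C) \<Longrightarrow> a u y = 0 \<and> a y u = 0" "generic_depth C k"
proof -
  obtain \<phi> where phi: "functional \<phi>" "\<And>y. y \<in> span B \<Longrightarrow> \<phi> y = 0 \<longleftrightarrow> a u y = 0 \<and> a y u = 0"
    using pencil_eigenvector_annihilator[OF u(1)] by blast
  have uB: "u \<in> span B" "u \<noteq> 0" "\<phi> u = 0" using u phi(2)[of u] by (auto simp: pencil_eigenvector_def)
  have u1: "independent {u}" using uB(2) by (simp add: dependent_single)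
  have u2: "{u} \<subseteq> {x \<in> span B. \<phi> x = 0}" using uB by simp
  obtain D where D: "finite D" "independent D" "{u} \<subseteq> D" "span D = {x \<in> span B. \<phi> x = 0}"
    by (rule kernel_basis[OF B phi(1) u1 u2])
  define C where "C = D - {u}"
  have C: "finite C" "u \<notin> C" "D = insert u C" "card D = Suc (card C)"
    using D(1,3) card_Suc_Diff1[OF D(1), of u] unfolding C_def by auto
  have iC: "independent C" using D(2) C(3) independent_mono by blast
  have orth: "a u y = 0 \<and> a y u = 0" if "y \<in> span D" for y
    using that phi(2) D(4) by auto
  have CD: "span C \<subseteq> span D" using C(3) span_mono by blast
  have CB: "span C \<subseteq> span B" using D(4) CD by auto
  obtain F where F: "finite F" "\<And>\<omega> N. cmod \<omega> = 1 \<Longrightarrow> \<omega> \<notin> F \<Longrightarrow> finite N \<Longrightarrow> independent N \<Longrightarrow> N \<subseteq> span B \<Longrightarrow>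
    negative_on \<omega> (span N) \<Longrightarrow> card N + Suc k \<le> card B"
    using depth unfolding generic_depth_def by metis
  have "generic_depth C k \<and> card C < card B"
  proof (cases "\<exists>b\<in>span B. \<phi> b \<noteq> 0")
    case False
    then have "span D = span B" using D(4) by auto
    then have cB: "card B = Suc (card C)" using card_eq_of_span_eq[OF B D(1,2)] C(4) by simp
    have "generic_depth C k" unfolding generic_depth_def
    proof (intro exI[of _ F] conjI allI impI F(1))
      fix \<omega> N assume h: "cmod \<omega> = 1" "\<omega> \<notin> F" "finite N" "independent N" "N \<subseteq> span C" "negative_on \<omega> (span N)"
      then show "card N + k \<le> card C" using F(2)[of \<omega> N] CB cB by auto
    qed
    then show ?thesis using cB by simp
  next
    case True
    then obtain b where b: "b \<in> span B" "\<phi> b \<noteq> 0" by blast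
    have cB: "card B = Suc (Suc (card C))" using basis_insert_kernel(3)[OF B phi(1) D(1,2,4) b] C(4) by simp
    define S where "S = {\<omega>. cmod \<omega> = 1 \<and> \<omega> * a b u + cnj (\<omega> * a u b) = 0}"
    have "a b u \<noteq> 0 \<or> a u b \<noteq> 0" using phi(2)[OF b(1)] b(2) by auto
    then have S: "finite S" unfolding S_def by (rule finite_singular_directions)
    have "generic_depth C k" unfolding generic_depth_def
    proof (intro exI[of _ "F \<union> S"] conjI allI impI)
      show "finite (F \<union> S)" using F(1) S by simp
      fix \<omega> N assume h: "cmod \<omega> = 1" "\<omega> \<notin> F \<union> S" "finite N" "independent N" "N \<subseteq> span C" "negative_on \<omega> (span N)"
      have NC: "span N \<subseteq> span C" using h(5) by (simp add: span_minimal)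
      have nz: "\<omega> * a b u + cnj (\<omega> * a u b) \<noteq> 0" using h(1,2) by (auto simp: S_def)
      obtain y where y: "y \<in> span (insert b (insert u N))" "y \<notin> span N" "negative_on \<omega> (span (insert y N))"
        using negative_extension[OF h(3,4,6) u(2) _ nz] orth NC CD by blast
      have yN: "y \<notin> N" using y(2) span_base by blast
      have "insert b (insert u N) \<subseteq> span B" using b(1) uB(1) h(5) CB by auto
      then have "y \<in> span B" using y(1) span_minimal[OF _ subspace_span] by blast
      then have "card (insert y N) + Suc k \<le> card B"
        using F(2)[OF h(1), of "insert y N"] h y independent_insertI[OF y(2) h(4)] CB by auto
      then show "card N + k \<le> card C" using cB yN h(3) by simp
    qed
    then show ?thesis using cB by simp
  qed
  then show thesis
    using that[of C] C D(2) orth D(4) by auto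
qed

end

section \<open>Interlacing sequences and isometries\<close>

text \<open>
  The sum is the coefficient of the highest possible degree \<open>card S - 1\<close> in the Lagrange interpolation
  polynomial of \<open>p\<close> on \<open>S\<close>, which is \<open>p\<close> itself.
\<close>
lemma lagrange_sum_eq_0:
  fixes S :: "'a::field set"
  assumes S: "finite S" and deg: "Suc (degree p) < card S"
  shows "(\<Sum>x\<in>S. poly p x / (\<Prod>y\<in>S - {x}. x - y)) = 0"
proof -
  define w where "w x = poly p x / (\<Prod>y\<in>S - {x}. x - y)" for x
  define L where "L x = (\<Prod>y\<in>S - {x}. [:- y, 1:])" for x
  define q where "q = (\<Sum>x\<in>S. smult (w x) (L x))"
  have degL: "degree (L x) = card S - 1" if "x \<in> S" for x
    unfolding L_def using that S by (subst degree_prod_eq_sum_degree) auto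
  have lcL: "coeff (L x) (card S - 1) = 1" if "x \<in> S" for x
    using degL[OF that] lead_coeff_prod[of "\<lambda>y. [:- y, 1:]" "S - {x}"] by (simp add: L_def)
  have polyL: "poly (L x) z = (\<Prod>y\<in>S - {x}. z - y)" for x z
    by (simp add: L_def poly_prod)
  have "poly q z = poly p z" if z: "z \<in> S" for z
  proof -
    have "poly q z = (\<Sum>x\<in>S. w x * (\<Prod>y\<in>S - {x}. z - y))"
      by (simp add: q_def poly_sum polyL)
    also have "\<dots> = (\<Sum>x\<in>S. if x = z then w z * (\<Prod>y\<in>S - {z}. z - y) else 0)"
      using S z by (intro sum.cong) (auto intro!: prod_zero)
    also have "\<dots> = w z * (\<Prod>y\<in>S - {z}. z - y)" using S z by simp
    also have "\<dots> = poly p z" unfolding w_def using S by auto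
    finally show ?thesis .
  qed
  then have "S \<subseteq> {z. poly (q - p) z = 0}" by auto
  moreover have "degree q \<le> card S - 1" unfolding q_def using degL
    by (intro degree_sum_le S) (auto intro: order.trans[OF degree_smult_le])
  then have "degree (q - p) < card S" using deg by (intro degree_diff_less) auto
  ultimately have "q - p = 0"
    using card_poly_roots_bound[of "q - p"] card_mono[OF poly_roots_finite[of "q - p"]] by (meson leD order.trans)
  then have "coeff q (card S - 1) = coeff p (card S - 1)" by simp
  also have "\<dots> = 0" using deg by (intro coeff_eq_0) auto
  also have "coeff q (card S - 1) = (\<Sum>x\<in>S. w x)"
    by (simp add: q_def coeff_sum lcL[unfolded One_nat_def])
  finally show ?thesis by (simp add: w_def)
qed

text \<open>
  The weights are the residues of the rational function whose zeros are the \<open>a i\<close> and whose poles are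
  the \<open>b j\<close>; the sum is the value of that function at the zero \<open>a i\<close>, up to sign.  Interlacing makes all
  residues positive.
\<close>
lemma interlacing_weights:
  fixes a b :: "nat \<Rightarrow> real"
  assumes lt: "\<And>l. l < r \<Longrightarrow> b l < a l \<and> a l < b (Suc l)"
  obtains \<kappa> where "\<And>j. j \<le> r \<Longrightarrow> \<kappa> j > 0" "\<And>i. i < r \<Longrightarrow> (\<Sum>j\<le>r. \<kappa> j / (b j - a i)) = 0"
proof -
  have bmono: "b i < b j" if "i < j" "j \<le> r" for i j
    using that
  proof (induction j)
    case (Suc j)
    then show ?case using lt[of j] by (cases "i = j") force+
  qed simp
  have ab: "a i < b j" if "i < j" "j \<le> r" for i j
    using lt[of i] bmono[of "Suc i" j] that by (cases "j = Suc i") force+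
  have ba: "b j < a i" if "j \<le> i" "i < r" for i j
    using lt[of i] bmono[of j i] that by (cases "j = i") force+
  define \<kappa> where "\<kappa> j = (\<Prod>i<r. b j - a i) / (\<Prod>l\<in>{..r} - {j}. b j - b l)" for j
  have pos: "\<kappa> j > 0" if j: "j \<le> r" for j
  proof -
    \<comment> \<open>Pair \<open>a i\<close> with \<open>b i\<close> to the left of \<open>b j\<close> and with \<open>b (i + 1)\<close> to its right: each quotient is positive.\<close>
    have e1: "{..r} - {j} = {..<j} \<union> Suc ` {j..<r}"
      using j by (auto simp: image_iff Bex_def)
    have "(\<Prod>l\<in>{..r} - {j}. b j - b l) = (\<Prod>l<j. b j - b l) * (\<Prod>l\<in>{j..<r}. b j - b (Suc l))"
    proof -
      have "(\<Prod>l\<in>{..r} - {j}. b j - b l) = (\<Prod>l<j. b j - b l) * (\<Prod>l\<in>Suc ` {j..<r}. b j - b l)"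
        unfolding e1 by (rule prod.union_disjoint) auto
      also have "(\<Prod>l\<in>Suc ` {j..<r}. b j - b l) = (\<Prod>l\<in>{j..<r}. b j - b (Suc l))"
        using prod.reindex[of Suc "{j..<r}" "\<lambda>l. b j - b l"] by (simp only: o_def inj_Suc inj_on_subset[OF inj_Suc subset_UNIV])
      finally show ?thesis .
    qed
    moreover have "(\<Prod>i<r. b j - a i) = (\<Prod>i<j. b j - a i) * (\<Prod>i\<in>{j..<r}. b j - a i)"
      using j by (subst prod.union_disjoint[symmetric]) (auto intro: prod.cong simp: ivl_disj_un)
    ultimately have "\<kappa> j = (\<Prod>i<j. (b j - a i) / (b j - b i)) * (\<Prod>i\<in>{j..<r}. (b j - a i) / (b j - b (Suc i)))"
      by (simp add: \<kappa>_def prod_dividef)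
    moreover have "(\<Prod>i<j. (b j - a i) / (b j - b i)) > 0"
      using ab bmono j by (intro prod_pos) auto
    moreover have "(\<Prod>i\<in>{j..<r}. (b j - a i) / (b j - b (Suc i))) > 0"
      using ba bmono j by (intro prod_pos ballI divide_neg_neg) auto
    ultimately show ?thesis by simp
  qed
  have zero: "(\<Sum>j\<le>r. \<kappa> j / (b j - a i)) = 0" if i: "i < r" for i
  proof -
    define p where "p = (\<Prod>l\<in>{..<r} - {i}. [:- a l, 1:])"
    have inj: "inj_on b {..r}" using bmono by (metis atMost_iff inj_onI less_irrefl linorder_neqE_nat)
    have "degree p = r - 1" unfolding p_def using i by (subst degree_prod_eq_sum_degree) auto
    then have "(\<Sum>x\<in>b ` {..r}. poly p x / (\<Prod>y\<in>b ` {..r} - {x}. x - y)) = 0"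
      using i by (intro lagrange_sum_eq_0) (auto simp: card_image inj)
    then have "0 = (\<Sum>j\<le>r. poly p (b j) / (\<Prod>y\<in>b ` {..r} - {b j}. b j - y))"
      by (simp add: sum.reindex inj)
    also have "\<dots> = (\<Sum>j\<le>r. \<kappa> j / (b j - a i))"
    proof (intro sum.cong refl)
      fix j assume j: "j \<in> {..r}"
      have "b ` {..r} - {b j} = b ` ({..r} - {j})" using inj j by (auto simp: inj_on_eq_iff)
      then have "(\<Prod>y\<in>b ` {..r} - {b j}. b j - y) = (\<Prod>l\<in>{..r} - {j}. b j - b l)"
        using inj by (simp add: prod.reindex inj_on_diff)
      moreover have "b j - a i \<noteq> 0" using ab[of i j] ba[of j i] i j by (cases "j \<le> i") force+
      moreover have "(\<Prod>l<r. b j - a l) = (b j - a i) * poly p (b j)"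
        using i by (simp add: p_def poly_prod prod.remove[of "{..<r}" i])
      ultimately show "poly p (b j) / (\<Prod>y\<in>b ` {..r} - {b j}. b j - y) = \<kappa> j / (b j - a i)"
        by (simp add: \<kappa>_def)
    qed
    finally show ?thesis by simp
  qed
  show thesis using that pos zero by blast
qed

text \<open>
  The converse of Cauchy's interlacing theorem in codimension one: \<open>Y\<close> has orthonormal columns and
  compresses the diagonal matrix with entries \<open>b\<close> to the one with entries \<open>a\<close>.  The columns are
  eigenvectors of the compression, \<open>Y j i\<close> being proportional to \<open>sqrt (\<kappa> j) / (b j - a i)\<close>; their
  orthogonality follows from the vanishing of the weighted sums by partial fractions.
\<close>
lemma interlacing_isometry_step:
  fixes a b :: "nat \<Rightarrow> real"
  assumes lt: "\<And>l. l < r \<Longrightarrow> b l < a l \<and> a l < b (Suc l)"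
  shows "\<exists>Y. \<forall>i<r. \<forall>i'<r. (\<Sum>j\<le>r. Y j i * Y j i') = (if i = i' then 1 else 0) \<and>
     (\<Sum>j\<le>r. b j * (Y j i * Y j i')) = (if i = i' then a i else (0::real))"
proof -
  obtain \<kappa> where pos: "\<And>j. j \<le> r \<Longrightarrow> \<kappa> j > 0" and zero: "\<And>i. i < r \<Longrightarrow> (\<Sum>j\<le>r. \<kappa> j / (b j - a i)) = 0"
    using interlacing_weights[of r b a, OF lt] by blast
  have amono: "a i < a j" if "i < j" "j < r" for i j
    using that
  proof (induction j)
    case (Suc j)
    then show ?case using lt[of j] lt[of "Suc j"] by (cases "i = j") force+
  qed simp
  have bmono: "b i < b j" if "i < j" "j \<le> r" for i j
    using that
  proof (induction j)
    case (Suc j)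
    then show ?case using lt[of j] by (cases "i = j") force+
  qed simp
  have ne: "b j \<noteq> a i" if "j \<le> r" "i < r" for i j
    using lt[of i] bmono[of j i] bmono[of "Suc i" j] that
    by (cases "j \<le> i"; cases "j = i"; cases "j = Suc i") force+
  define N where "N i = (\<Sum>j\<le>r. \<kappa> j / (b j - a i)\<^sup>2)" for i
  have Npos: "N i > 0" if "i < r" for i
    unfolding N_def using pos ne that by (intro sum_pos divide_pos_pos) auto
  define K where "K i i' = (\<Sum>j\<le>r. \<kappa> j / ((b j - a i) * (b j - a i')))" for i i'
  have K0: "K i i' = 0" if "i < r" "i' < r" "i \<noteq> i'" for i i'
  proof -
    have aa: "a i \<noteq> a i'" using amono[of i i'] amono[of i' i] that by (cases "i < i'") force+
    have "\<kappa> j / ((b j - a i) * (b j - a i')) = (\<kappa> j / (b j - a i) - \<kappa> j / (b j - a i')) / (a i - a i')"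
      if "j \<le> r" for j
      using ne[OF that \<open>i < r\<close>] ne[OF that \<open>i' < r\<close>] aa by (simp add: divide_simps) (simp add: algebra_simps)
    then have "K i i' = (\<Sum>j\<le>r. (\<kappa> j / (b j - a i) - \<kappa> j / (b j - a i')) / (a i - a i'))"
      unfolding K_def by (intro sum.cong) auto
    also have "\<dots> = 0" using zero that by (simp add: sum_divide_distrib[symmetric] sum_subtractf)
    finally show ?thesis .
  qed
  have KN: "K i i = N i" for i by (simp add: K_def N_def power2_eq_square)
  have Kb: "(\<Sum>j\<le>r. b j * (\<kappa> j / ((b j - a i) * (b j - a i')))) = a i * K i i'" if "i < r" "i' < r" for i i'
  proof -
    have "b j * (\<kappa> j / ((b j - a i) * (b j - a i'))) = a i * (\<kappa> j / ((b j - a i) * (b j - a i'))) + \<kappa> j / (b j - a i')"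
      if "j \<le> r" for j
      using ne[OF that \<open>i < r\<close>] ne[OF that \<open>i' < r\<close>] by (simp add: divide_simps) (simp add: algebra_simps)
    then have "(\<Sum>j\<le>r. b j * (\<kappa> j / ((b j - a i) * (b j - a i')))) =
      (\<Sum>j\<le>r. a i * (\<kappa> j / ((b j - a i) * (b j - a i'))) + \<kappa> j / (b j - a i'))"
      by (intro sum.cong) auto
    then show ?thesis using zero[OF that(2)] by (simp add: sum.distrib K_def sum_distrib_left)
  qed
  define Y where "Y j i = sqrt (\<kappa> j) / ((b j - a i) * sqrt (N i))" for j i
  have Y: "Y j i * Y j i' = \<kappa> j / ((b j - a i) * (b j - a i')) / (sqrt (N i) * sqrt (N i'))" if "j \<le> r" for i i' j
    using pos[OF that] by (simp add: Y_def)
  have s1: "(\<Sum>j\<le>r. Y j i * Y j i') = K i i' / (sqrt (N i) * sqrt (N i'))" for i i'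
    by (simp add: Y K_def sum_divide_distrib)
  have s2: "(\<Sum>j\<le>r. b j * (Y j i * Y j i')) = a i * K i i' / (sqrt (N i) * sqrt (N i'))" if "i < r" "i' < r" for i i'
    by (simp add: Y Kb[OF that, symmetric] sum_divide_distrib)
  show ?thesis
  proof (intro exI[of _ Y] allI impI conjI)
    fix i i' assume h: "i < r" "i' < r"
    show "(\<Sum>j\<le>r. Y j i * Y j i') = (if i = i' then 1 else 0)"
      unfolding s1 using K0[OF h] Npos[OF h(1)] by (auto simp: KN)
    show "(\<Sum>j\<le>r. b j * (Y j i * Y j i')) = (if i = i' then a i else 0)"
      unfolding s2[OF h] using K0[OF h] Npos[OF h(1)] by (auto simp: KN)
  qed
qed

text \<open>
  The converse of Cauchy's interlacing theorem in codimension \<open>w\<close> (Fan and Pall).  The indices in one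
  residue class modulo \<open>w\<close> form a chain \<open>b c < a c < b (c + w) < a (c + w) < \<dots>\<close>, which starts and ends
  with an entry of \<open>b\<close> and so is an instance of the case of codimension one.  The isometry is the direct
  sum over the residue classes.
\<close>
lemma interlacing_isometry:
  fixes a b :: "nat \<Rightarrow> real"
  assumes lt: "\<And>i. i < q \<Longrightarrow> b i < a i \<and> a i < b (i + w)"
  shows "\<exists>Y. \<forall>i<q. \<forall>i'<q. (\<Sum>j<q + w. Y j i * Y j i') = (if i = i' then 1 else 0) \<and>
     (\<Sum>j<q + w. b j * (Y j i * Y j i')) = (if i = i' then a i else (0::real))"
proof (cases "q = 0")
  case False
  then have w0: "w > 0" using lt[of 0] by (cases w) auto
  \<comment> \<open>The number of indices below \<open>q\<close> in the residue class of \<open>c\<close>.\<close>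
  define r where "r c = (LEAST l. q \<le> c + l * w)" for c
  have rle: "q \<le> c + r c * w" for c
    unfolding r_def by (rule LeastI[of _ q]) (use w0 in \<open>simp add: trans_le_add2\<close>)
  have rl: "l < r c \<longleftrightarrow> c + l * w < q" for c l
  proof
    assume "l < r c"
    then show "c + l * w < q" unfolding r_def using not_less_Least by (metis not_le)
  next
    assume h: "c + l * w < q"
    show "l < r c"
    proof (rule ccontr)
      assume "\<not> l < r c"
      then have "r c * w \<le> l * w" by simp
      then show False using h rle[of c] by linarith
    qed
  qed
  define Q where "Q c Y \<longleftrightarrow> (\<forall>i<r c. \<forall>i'<r c. (\<Sum>j\<le>r c. Y j i * Y j i') = (if i = i' then 1 else 0) \<and>
     (\<Sum>j\<le>r c. b (c + j * w) * (Y j i * Y j i')) = (if i = i' then a (c + i * w) else (0::real)))" for c Y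
  have "\<exists>Y. Q c Y" for c unfolding Q_def
  proof (rule interlacing_isometry_step)
    fix l assume l: "l < r c"
    have e: "c + Suc l * w = (c + l * w) + w" by simp
    show "b (c + l * w) < a (c + l * w) \<and> a (c + l * w) < b (c + Suc l * w)"
      unfolding e using l lt unfolding rl by blast
  qed
  then have "\<forall>c. \<exists>Y. Q c Y" by blast
  from choice[OF this] obtain Yc where Q: "\<forall>c. Q c (Yc c)" ..
  have Yc: "(\<Sum>j\<le>r c. Yc c j i * Yc c j i') = (if i = i' then 1 else 0) \<and>
     (\<Sum>j\<le>r c. b (c + j * w) * (Yc c j i * Yc c j i')) = (if i = i' then a (c + i * w) else 0)"
    if "i < r c" "i' < r c" for c i i'
    using Q that unfolding Q_def by blast
  define Y where "Y j i = (if j mod w = i mod w then Yc (i mod w) (j div w) (i div w) else 0)" for j i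
  have red: "(\<Sum>j<q + w. f j * (Y j i * Y j i')) =
     (if i mod w = i' mod w then (\<Sum>l\<le>r (i mod w). f (i mod w + l * w) * (Yc (i mod w) l (i div w) * Yc (i mod w) l (i' div w))) else 0)" for f i i'
  proof (cases "i mod w = i' mod w")
    case True
    define c where "c = i mod w"
    have c: "c < w" using w0 by (simp add: c_def)
    have inj: "inj_on (\<lambda>l. c + l * w) {..r c}" using w0 by (auto simp: inj_on_def)
    have img: "(\<lambda>l. c + l * w) ` {..r c} = {j \<in> {..<q + w}. j mod w = c}"
    proof (intro equalityI subsetI)
      fix j assume "j \<in> (\<lambda>l. c + l * w) ` {..r c}"
      then obtain l where l: "l \<le> r c" "j = c + l * w" by auto
      have "c + l * w < q + w"
      proof (cases l)
        case (Suc l')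
        then have "c + l' * w < q" using l(1) rl[of l' c] by simp
        then show ?thesis using Suc by simp
      qed (use c in simp)
      then show "j \<in> {j \<in> {..<q + w}. j mod w = c}" using l(2) c by simp
    next
      fix j assume "j \<in> {j \<in> {..<q + w}. j mod w = c}"
      then have j: "j < q + w" "c = j mod w" by auto
      have e: "j = j mod w + (j div w) * w" by simp
      have "j div w \<le> r c"
      proof (cases "j div w")
        case (Suc l)
        have "j = c + Suc l * w" using e unfolding Suc j(2)[symmetric] .
        then have "j = c + l * w + w" by simp
        then have "l < r c" unfolding rl using j(1) by simp
        then show ?thesis using Suc by simp
      qed simp
      then show "j \<in> (\<lambda>l. c + l * w) ` {..r c}" using e unfolding j(2)[symmetric] by blast
    qed
    have "(\<Sum>j<q + w. f j * (Y j i * Y j i')) = (\<Sum>j\<in>{j \<in> {..<q + w}. j mod w = c}. f j * (Y j i * Y j i'))"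
      by (rule sum.mono_neutral_right) (auto simp: Y_def c_def)
    also have "\<dots> = (\<Sum>l\<le>r c. f (c + l * w) * (Y (c + l * w) i * Y (c + l * w) i'))"
      unfolding img[symmetric] by (simp add: sum.reindex[OF inj])
    also have "\<dots> = (\<Sum>l\<le>r c. f (c + l * w) * (Yc c l (i div w) * Yc c l (i' div w)))"
      using c True by (intro sum.cong refl) (simp add: Y_def c_def)
    finally show ?thesis using True by (simp add: c_def)
  next
    case False
    then show ?thesis by (auto simp: Y_def intro!: sum.neutral)
  qed
  show ?thesis
  proof (intro exI[of _ Y] allI impI)
    fix i i' assume h: "i < q" "i' < q"
    have d: "i div w < r (i mod w)" "i' div w < r (i' mod w)" unfolding rl using h by simp_all
    have ii: "i = i' \<longleftrightarrow> i mod w = i' mod w \<and> i div w = i' div w"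
      by (metis div_mult_mod_eq)
    have s1: "(\<Sum>j<q + w. Y j i * Y j i') = (if i = i' then 1 else 0)"
      using red[of "\<lambda>_. 1" i i'] Yc[OF d(1), of "i' div w"] d ii by auto
    have s2: "(\<Sum>j<q + w. b j * (Y j i * Y j i')) = (if i = i' then a i else 0)"
      using red[of b i i'] Yc[OF d(1), of "i' div w"] d ii by auto
    show "(\<Sum>j<q + w. Y j i * Y j i') = (if i = i' then 1 else 0) \<and>
     (\<Sum>j<q + w. b j * (Y j i * Y j i')) = (if i = i' then a i else 0)" using s1 s2 by blast
  qed
qed simp

lemma sorted_enumeration:
  fixes t :: "'a \<Rightarrow> 'b::linorder"
  assumes "finite P"
  shows "\<exists>ps. bij_betw ps {..<card P} P \<and> (\<forall>j<card P. \<forall>i\<le>j. t (ps i) \<le> t (ps j))"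
proof -
  obtain xs where xs: "set xs = P" "distinct xs" using finite_distinct_list[OF assms] by blast
  define ys where "ys = sort_key t xs"
  have ys: "set ys = P" "distinct ys" "length ys = card P" "sorted (map t ys)"
    using xs distinct_card[OF xs(2)] by (simp_all add: ys_def)
  have "bij_betw ((!) ys) {..<card P} P" using ys by (intro bij_betw_nth) auto
  moreover have "t (ys ! i) \<le> t (ys ! j)" if "i \<le> j" "j < card P" for i j
    using sorted_nth_mono[OF ys(4) that(1)] that ys(3) by simp
  ultimately show ?thesis by blast
qed

text \<open>
  Turns counting conditions into interlacing: enumerate both sets by increasing \<open>t\<close>.
\<close>
lemma interlacing_enumeration:
  fixes t :: "'a \<Rightarrow> 'b::linorder"
  assumes fin: "finite P" "finite M"
    and lower: "\<And>p. p \<in> P \<Longrightarrow> card {x \<in> P. t x \<le> t p} \<le> card {x \<in> M. t x < t p}"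
    and upper: "\<And>p. p \<in> P \<Longrightarrow> card {x \<in> P. t p \<le> t x} \<le> card {x \<in> M. t p < t x}"
    and ne: "P \<noteq> {}"
  obtains w ps ms where "card M = card P + w" "bij_betw ps {..<card P} P" "bij_betw ms {..<card M} M"
    "\<forall>i<card P. t (ms i) < t (ps i) \<and> t (ps i) < t (ms (i + w))"
proof -
  obtain ps where "bij_betw ps {..<card P} P \<and> (\<forall>j<card P. \<forall>i\<le>j. t (ps i) \<le> t (ps j))"
    using sorted_enumeration[OF fin(1)] ..
  then have ps: "bij_betw ps {..<card P} P" "\<And>i j. i \<le> j \<Longrightarrow> j < card P \<Longrightarrow> t (ps i) \<le> t (ps j)" by auto
  obtain ms where "bij_betw ms {..<card M} M \<and> (\<forall>j<card M. \<forall>i\<le>j. t (ms i) \<le> t (ms j))"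
    using sorted_enumeration[OF fin(2)] ..
  then have ms: "bij_betw ms {..<card M} M" "\<And>i j. i \<le> j \<Longrightarrow> j < card M \<Longrightarrow> t (ms i) \<le> t (ms j)" by auto
  have psP: "ps i \<in> P" if "i < card P" for i using bij_betw_apply[OF ps(1)] that by simp
  have psc: "card (ps ` I) = card I" if "I \<subseteq> {..<card P}" for I
    using ps(1) that by (metis bij_betw_def card_image inj_on_subset)
  have msc: "card (ms ` I) \<le> card I" if "finite I" for I using card_image_le[OF that] .
  have below: "Suc i \<le> card {x \<in> M. t x < t (ps i)}" if i: "i < card P" for i
  proof -
    have "ps ` {..i} \<subseteq> {x \<in> P. t x \<le> t (ps i)}" using psP ps(2) i by auto
    then have "card (ps ` {..i}) \<le> card {x \<in> P. t x \<le> t (ps i)}" using fin by (intro card_mono) auto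
    moreover have "card (ps ` {..i}) = Suc i" using psc[of "{..i}"] i by (simp add: subset_iff)
    ultimately show ?thesis using lower[OF psP[OF i]] by simp
  qed
  have above: "card P - i \<le> card {x \<in> M. t (ps i) < t x}" if i: "i < card P" for i
  proof -
    have "ps ` {i..<card P} \<subseteq> {x \<in> P. t (ps i) \<le> t x}" using psP ps(2) i by auto
    then have "card (ps ` {i..<card P}) \<le> card {x \<in> P. t (ps i) \<le> t x}" using fin by (intro card_mono) auto
    moreover have "card (ps ` {i..<card P}) = card P - i" using psc[of "{i..<card P}"] by (simp add: subset_iff)
    ultimately show ?thesis using upper[OF psP[OF i]] by simp
  qed
  have "card P > 0" using ne fin by auto
  then have "card P \<le> card {x \<in> M. t (ps 0) < t x}" using above[of 0] by simp
  also have "\<dots> \<le> card M" using fin by (intro card_mono) auto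
  finally have PM: "card P \<le> card M" .
  have "t (ms i) < t (ps i) \<and> t (ps i) < t (ms (i + (card M - card P)))" if i: "i < card P" for i
  proof
    show "t (ms i) < t (ps i)"
    proof (rule ccontr)
      assume c: "\<not> t (ms i) < t (ps i)"
      have "{x \<in> M. t x < t (ps i)} \<subseteq> ms ` {..<i}"
      proof safe
        fix x assume x: "x \<in> M" "t x < t (ps i)"
        then obtain j where j: "j < card M" "x = ms j" using ms(1) by (auto simp: bij_betw_def)
        have "j < i" using c x(2) ms(2)[of i j] j by (meson leI le_less_trans)
        then show "x \<in> ms ` {..<i}" using j by auto
      qed
      then have "card {x \<in> M. t x < t (ps i)} \<le> card (ms ` {..<i})" by (intro card_mono) auto
      also have "\<dots> \<le> i" using msc[of "{..<i}"] by simp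
      finally show False using below[OF i] by simp
    qed
    show "t (ps i) < t (ms (i + (card M - card P)))"
    proof (rule ccontr)
      let ?k = "i + (card M - card P)"
      assume c: "\<not> t (ps i) < t (ms ?k)"
      have "{x \<in> M. t (ps i) < t x} \<subseteq> ms ` {?k<..<card M}"
      proof safe
        fix x assume x: "x \<in> M" "t (ps i) < t x"
        then obtain j where j: "j < card M" "x = ms j" using ms(1) by (auto simp: bij_betw_def)
        have k: "?k < card M" using i PM by linarith
        have "?k < j"
        proof (rule ccontr)
          assume "\<not> ?k < j"
          then have "t (ms j) \<le> t (ms ?k)" by (intro ms(2) k) simp
          then show False using c x(2) j(2) by (meson less_le_trans)
        qed
        then show "x \<in> ms ` {?k<..<card M}" using j by auto
      qed
      then have "card {x \<in> M. t (ps i) < t x} \<le> card (ms ` {?k<..<card M})" by (intro card_mono) auto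
      also have "\<dots> \<le> card M - Suc ?k" using msc[of "{?k<..<card M}"] by simp
      finally show False using above[OF i] i PM by simp
    qed
  qed
  then show thesis using that[of "card M - card P" ps ms] ps(1) ms(1) PM by simp
qed

section \<open>Diagonal forms\<close>

lemma finite_gap_right:
  fixes x :: real
  assumes "finite Bad" "finite T"
  shows "\<exists>s>x. s \<notin> Bad \<and> (\<forall>y\<in>T. x < y \<longrightarrow> s < y)"
proof -
  define v where "v = Min (insert (x + 1) {y \<in> T. x < y})"
  have v: "x < v" "\<And>y. y \<in> T \<Longrightarrow> x < y \<Longrightarrow> v \<le> y"
    using assms(2) by (auto simp: v_def)
  have "infinite ({x<..<v} - Bad)" using v(1) assms(1) by (simp add: infinite_Ioo)
  then obtain s where "s \<in> {x<..<v} - Bad" by (metis finite.emptyI ex_in_conv)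
  then show ?thesis using v(2) by (intro exI[of _ s]) force
qed

lemma finite_gap_left:
  fixes x :: real
  assumes "finite Bad" "finite T"
  shows "\<exists>s<x. s \<notin> Bad \<and> (\<forall>y\<in>T. y < x \<longrightarrow> y < s)"
proof -
  obtain s where s: "s > - x" "s \<notin> uminus ` Bad" "\<forall>y\<in>uminus ` T. - x < y \<longrightarrow> s < y"
    using finite_gap_right[of "uminus ` Bad" "uminus ` T" "-x"] assms by auto
  have "- s \<notin> Bad" using s(2) by (metis imageI minus_minus)
  then show ?thesis using s(1,3) by (intro exI[of _ "- s"]) force
qed

text \<open>
  The open half-plane \<open>Re (\<omega> z) > 0\<close> contains a minimal number of the points \<open>d u\<close>, among the half-planes
  outside a finite set of exceptional ones with no point on their boundary.  Turn it so that its
  boundary has slope \<open>s\<close> instead.  The points of \<open>P\<close> with slope on one side of \<open>s\<close> leave it and the points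
  of \<open>M\<close> with slope on the same side enter it, so minimality bounds the former number by the latter.
  The weak inequality for \<open>P\<close> and the strict one for \<open>M\<close> are compatible because a common slope would
  mean that the two points have opposite directions.
\<close>
lemma minimal_halfplane_interlacing:
  fixes d :: "'a \<Rightarrow> complex"
  assumes U: "finite U" and nz: "\<And>u. u \<in> U \<Longrightarrow> d u \<noteq> 0"
    and anti: "\<And>u v \<rho>. u \<in> U \<Longrightarrow> v \<in> U \<Longrightarrow> \<rho> > 0 \<Longrightarrow> d u \<noteq> - of_real \<rho> * d v"
    and F: "finite F" and depth: "\<And>\<omega>. cmod \<omega> = 1 \<Longrightarrow> \<omega> \<notin> F \<Longrightarrow> k \<le> card {u \<in> U. Re (\<omega> * d u) \<ge> 0}"
  obtains \<omega> P M t where "\<omega> \<noteq> 0" "P \<subseteq> U" "M \<subseteq> U" "P \<inter> M = {}" "k \<le> card P"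
    "\<And>u. u \<in> P \<Longrightarrow> Re (\<omega> * d u) > 0" "\<And>u. u \<in> M \<Longrightarrow> Re (\<omega> * d u) < 0"
    "\<And>u. u \<in> U \<Longrightarrow> \<omega> * d u = of_real (Re (\<omega> * d u)) * Complex 1 (t u)"
    "\<And>p. p \<in> P \<Longrightarrow> card {x \<in> P. t x \<le> t p} \<le> card {x \<in> M. t x < t p}"
    "\<And>p. p \<in> P \<Longrightarrow> card {x \<in> P. t p \<le> t x} \<le> card {x \<in> M. t p < t x}"
proof -
  define F' where "F' = F \<union> (\<Union>u\<in>U. {\<omega>. cmod \<omega> = 1 \<and> \<omega> * d u + cnj (\<omega> * d u) = 0})"
  have F': "finite F'"
    unfolding F'_def using F U nz by (auto intro!: finite_singular_directions simp del: complex_cnj_mult)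
  define np where "np \<omega> = card {u \<in> U. Re (\<omega> * d u) > 0}" for \<omega>
  define good where "good \<omega> \<longleftrightarrow> cmod \<omega> = 1 \<and> \<omega> \<notin> F'" for \<omega>
  have good0: "Re (\<omega> * d u) \<noteq> 0" if "good \<omega>" "u \<in> U" for \<omega> u
  proof
    assume "Re (\<omega> * d u) = 0"
    then have "\<omega> * d u + cnj (\<omega> * d u) = 0" by (simp only: complex_add_cnj) simp
    then show False using that by (auto simp: good_def F'_def)
  qed
  have goodk: "k \<le> np \<omega>" if "good \<omega>" for \<omega>
  proof -
    have "{u \<in> U. Re (\<omega> * d u) > 0} = {u \<in> U. Re (\<omega> * d u) \<ge> 0}"
      using good0[OF that] by (auto simp: less_le)
    then show ?thesis using depth[of \<omega>] that by (simp add: np_def good_def F'_def)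
  qed
  \<comment> \<open>The open upper half of the unit circle, parametrised so that \<open>Re (g s * e u)\<close> changes sign where \<open>s\<close> is the slope \<open>t u\<close>.\<close>
  define g where "g s = Complex s 1 / of_real (cmod (Complex s 1))" for s
  have nz1: "cmod (Complex s 1) > 0" for s by (simp add: complex_eq_iff)
  have g1: "cmod (g s) = 1" for s using nz1[of s] by (simp add: g_def norm_divide)
  have ginj: "inj g"
  proof (rule injI)
    fix s s' assume e: "g s = g s'"
    have r: "Re (g s) / Im (g s) = s" for s using nz1[of s] by (simp add: g_def)
    show "s = s'" using r[of s, unfolded e] r[of s'] by (rule trans[OF sym])
  qed
  have fin_g: "finite {s. g s * c \<in> F'}" if "c \<noteq> 0" for c
  proof -
    have "inj (\<lambda>s. g s * c)" using ginj that by (auto simp: inj_def)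
    from finite_vimageI[OF F' this] show ?thesis by (simp add: vimage_def)
  qed
  have "\<exists>\<omega>. good \<omega>"
  proof -
    obtain s where "s \<notin> {s. g s * 1 \<in> F'}" using fin_g[of 1] infinite_UNIV_char_0[where 'a=real] by (metis UNIV_eq_I one_neq_zero)
    then show ?thesis using g1 by (auto simp: good_def)
  qed
  then obtain \<omega> where w: "good \<omega>" and least: "\<And>\<omega>'. good \<omega>' \<Longrightarrow> np \<omega> \<le> np \<omega>'"
    using ex_has_least_nat[of good _ np] by blast
  have w1: "cmod \<omega> = 1" "\<omega> \<noteq> 0" using w by (auto simp: good_def)
  define e where "e u = \<omega> * d u" for u
  define t where "t u = Im (e u) / Re (e u)" for u
  define P where "P = {u \<in> U. Re (e u) > 0}"
  define M where "M = {u \<in> U. Re (e u) < 0}"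
  have fin: "finite P" "finite M" using U by (auto simp: P_def M_def)
  have e0: "Re (e u) \<noteq> 0" if "u \<in> U" for u using good0[OF w that] by (simp add: e_def)
  have form: "e u = of_real (Re (e u)) * Complex 1 (t u)" if "u \<in> U" for u
    using e0[OF that] by (simp add: t_def complex_eq_iff)
  have sgn: "Re (g s * e u) = Re (e u) * (s - t u) / cmod (Complex s 1)" if "u \<in> U" for s u
    using e0[OF that] nz1[of s] by (simp add: g_def t_def field_simps)
  have pos_iff: "Re (g s * e u) > 0 \<longleftrightarrow> (u \<in> P \<and> t u < s \<or> u \<in> M \<and> s < t u)" if "u \<in> U" for s u
    unfolding sgn[OF that] using nz1[of s] that e0[OF that]
    by (auto simp: P_def M_def zero_less_divide_iff zero_less_mult_iff)
  have neg_iff: "Re (- g s * e u) > 0 \<longleftrightarrow> (u \<in> P \<and> s < t u \<or> u \<in> M \<and> t u < s)" if "u \<in> U" for s u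
  proof -
    have "Re (- g s * e u) > 0 \<longleftrightarrow> Re (g s * e u) < 0" by simp
    then show ?thesis unfolding sgn[OF that] using nz1[of s] that e0[OF that]
      by (auto simp: P_def M_def divide_less_0_iff mult_less_0_iff)
  qed
  define Bad where "Bad = {s. g s * \<omega> \<in> F'} \<union> {s. g s * (- \<omega>) \<in> F'}"
  have Bad: "finite Bad" using fin_g[of \<omega>] fin_g[of "- \<omega>"] w1(2) by (simp add: Bad_def)
  have PM: "P \<inter> M = {}" "P \<subseteq> U" "M \<subseteq> U" by (auto simp: P_def M_def)
  have npw: "np \<omega> = card P" by (simp add: np_def P_def e_def)
  have up: "card {x \<in> P. s \<le> t x} \<le> card {x \<in> M. s < t x}" if s: "s \<notin> Bad" for s
  proof -
    have "good (g s * \<omega>)" using s g1 w1 by (simp add: good_def Bad_def norm_mult)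
    then have "card P \<le> np (g s * \<omega>)" using least npw by metis
    also have "{u \<in> U. Re (g s * \<omega> * d u) > 0} = {x \<in> P. t x < s} \<union> {x \<in> M. s < t x}"
      using pos_iff[of _ s] PM by (auto simp: e_def mult.assoc)
    then have "np (g s * \<omega>) = card {x \<in> P. t x < s} + card {x \<in> M. s < t x}"
      using fin PM(1) by (simp add: np_def) (subst card_Un_disjoint; auto)
    finally have "card P \<le> card {x \<in> P. t x < s} + card {x \<in> M. s < t x}" .
    moreover have "P = {x \<in> P. t x < s} \<union> {x \<in> P. s \<le> t x}" by auto
    then have "card P = card {x \<in> P. t x < s} + card {x \<in> P. s \<le> t x}"
      using fin by (subst card_Un_disjoint[symmetric]) auto
    ultimately show ?thesis by simp
  qed
  have down: "card {x \<in> P. t x \<le> s} \<le> card {x \<in> M. t x < s}" if s: "s \<notin> Bad" for s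
  proof -
    have "good (g s * - \<omega>)" using s g1 w1 by (simp add: good_def Bad_def norm_mult)
    then have "card P \<le> np (g s * - \<omega>)" using least npw by metis
    also have "{u \<in> U. Re (g s * - \<omega> * d u) > 0} = {x \<in> P. s < t x} \<union> {x \<in> M. t x < s}"
      using neg_iff[of _ s] PM by (auto simp: e_def mult.assoc)
    then have "np (g s * - \<omega>) = card {x \<in> P. s < t x} + card {x \<in> M. t x < s}"
      using fin PM(1) unfolding np_def by (simp only:) (subst card_Un_disjoint; auto)
    finally have "card P \<le> card {x \<in> P. s < t x} + card {x \<in> M. t x < s}" .
    moreover have "P = {x \<in> P. s < t x} \<union> {x \<in> P. t x \<le> s}" by auto
    then have "card P = card {x \<in> P. s < t x} + card {x \<in> P. t x \<le> s}"
      using fin by (subst card_Un_disjoint[symmetric]) auto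
    ultimately show ?thesis by simp
  qed
  have tne: "t m \<noteq> t p" if "m \<in> M" "p \<in> P" for m p
  proof
    assume tt: "t m = t p"
    define \<rho> where "\<rho> = - Re (e m) / Re (e p)"
    have rho: "\<rho> > 0" using that by (simp add: \<rho>_def P_def M_def divide_neg_pos)
    have "e m = of_real (Re (e m)) * Complex 1 (t p)" using form[of m] that PM tt by auto
    also have "\<dots> = - of_real \<rho> * (of_real (Re (e p)) * Complex 1 (t p))"
      using e0[of p] that PM by (auto simp: \<rho>_def)
    also have "\<dots> = - of_real \<rho> * e p" using form[of p] that PM by auto
    finally have "\<omega> * d m = \<omega> * (- of_real \<rho> * d p)" by (simp add: e_def mult.left_commute)
    then have "d m = - of_real \<rho> * d p" using w1(2) mult_left_cancel by blast
    then show False using anti[OF _ _ rho] that PM by blast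
  qed
  show thesis
  proof (rule that[of \<omega> P M t])
    show "k \<le> card P" using goodk[OF w] npw by simp
    fix p assume p: "p \<in> P"
    \<comment> \<open>A non-exceptional slope so close to \<open>t p\<close> that no point of \<open>M\<close> has its slope in between.\<close>
    obtain s where s: "t p < s" "s \<notin> Bad" "\<forall>y\<in>t ` M. t p < y \<longrightarrow> s < y"
      using finite_gap_right[OF Bad, of "t ` M" "t p"] fin by auto
    have "card {x \<in> P. t x \<le> t p} \<le> card {x \<in> P. t x \<le> s}" using fin s by (intro card_mono) auto
    also have "\<dots> \<le> card {x \<in> M. t x < s}" by (rule down[OF s(2)])
    also have "\<dots> \<le> card {x \<in> M. t x < t p}"
      using fin s(3) tne[OF _ p] by (intro card_mono) (force simp: not_less[symmetric])+
    finally show "card {x \<in> P. t x \<le> t p} \<le> card {x \<in> M. t x < t p}" .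
    obtain s where s: "s < t p" "s \<notin> Bad" "\<forall>y\<in>t ` M. y < t p \<longrightarrow> y < s"
      using finite_gap_left[OF Bad, of "t ` M" "t p"] fin by auto
    have "card {x \<in> P. t p \<le> t x} \<le> card {x \<in> P. s \<le> t x}" using fin s by (intro card_mono) auto
    also have "\<dots> \<le> card {x \<in> M. s < t x}" by (rule up[OF s(2)])
    also have "\<dots> \<le> card {x \<in> M. t p < t x}"
      using fin s(3) tne[OF _ p] by (intro card_mono) (force simp: not_less[symmetric])+
    finally show "card {x \<in> P. t p \<le> t x} \<le> card {x \<in> M. t p < t x}" .
  qed (use w1 PM form in \<open>auto simp: P_def M_def e_def\<close>)
qed

context sesquilinear_form
begin

text \<open>
  After multiplication by \<open>\<omega>\<close> and rescaling, the form is \<open>1 + \<i> t(u)\<close> on the basis vectors \<open>u \<in> P\<close> and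
  \<open>- (1 + \<i> t(u))\<close> on those in \<open>M\<close>.  A column of the isometry \<open>Y\<close> is a combination of vectors of \<open>M\<close>, and
  the two properties of \<open>Y\<close> say that these combinations reproduce the values on \<open>P\<close> with the opposite
  sign.  The sum of a vector of \<open>P\<close> and its column is therefore isotropic.
\<close>
lemma diagonal_isotropic:
  assumes U: "finite U" and orth: "\<And>u v. u \<in> U \<Longrightarrow> v \<in> U \<Longrightarrow> u \<noteq> v \<Longrightarrow> a u v = 0"
    and nz: "\<And>u. u \<in> U \<Longrightarrow> a u u \<noteq> 0"
    and anti: "\<And>u v \<rho>. u \<in> U \<Longrightarrow> v \<in> U \<Longrightarrow> \<rho> > 0 \<Longrightarrow> a u u \<noteq> - of_real \<rho> * a v v"
    and F: "finite F" and depth: "\<And>\<omega>. cmod \<omega> = 1 \<Longrightarrow> \<omega> \<notin> F \<Longrightarrow> k \<le> card {u \<in> U. Re (\<omega> * a u u) \<ge> 0}"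
  shows "\<exists>R. finite R \<and> independent R \<and> card R = k \<and> R \<subseteq> span U \<and> (\<forall>x\<in>R. \<forall>y\<in>R. a x y = 0)"
proof (rule minimal_halfplane_interlacing[of U "\<lambda>u. a u u" F k])
  fix \<omega> P M and t :: "'v \<Rightarrow> real"
  assume w: "\<omega> \<noteq> 0" and PM: "P \<subseteq> U" "M \<subseteq> U" "P \<inter> M = {}" and k: "k \<le> card P"
    and Ppos: "\<And>u. u \<in> P \<Longrightarrow> Re (\<omega> * a u u) > 0" and Mneg: "\<And>u. u \<in> M \<Longrightarrow> Re (\<omega> * a u u) < 0"
    and form: "\<And>u. u \<in> U \<Longrightarrow> \<omega> * a u u = of_real (Re (\<omega> * a u u)) * Complex 1 (t u)"
    and lower: "\<And>p. p \<in> P \<Longrightarrow> card {x \<in> P. t x \<le> t p} \<le> card {x \<in> M. t x < t p}"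
    and upper: "\<And>p. p \<in> P \<Longrightarrow> card {x \<in> P. t p \<le> t x} \<le> card {x \<in> M. t p < t x}"
  have fin: "finite P" "finite M" using PM U finite_subset by blast+
  show ?thesis
  proof (cases "P = {}")
    case True
    then show ?thesis using k by (intro exI[of _ "{}"]) (simp add: independent_empty)
  next
    case False
    obtain v ps ms where cM: "card M = card P + v" and ps: "bij_betw ps {..<card P} P"
      and ms: "bij_betw ms {..<card M} M"
      and il: "\<forall>i<card P. t (ms i) < t (ps i) \<and> t (ps i) < t (ms (i + v))"
      by (rule interlacing_enumeration[OF fin lower upper False])
    obtain Y where Y: "\<forall>i<card P. \<forall>i'<card P. (\<Sum>j<card P + v. Y j i * Y j i') = (if i = i' then 1 else 0) \<and>
       (\<Sum>j<card P + v. t (ms j) * (Y j i * Y j i')) = (if i = i' then t (ps i) else (0::real))"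
      using interlacing_isometry[of "card P" "\<lambda>i. t (ms i)" "\<lambda>i. t (ps i)" v] il by blast
    define q where "q = card P"
    define m where "m = card M"
    have psP: "ps i \<in> P" "ps i \<in> U" if "i < q" for i
      using bij_betw_apply[OF ps] that PM by (auto simp: q_def)
    have msM: "ms j \<in> M" "ms j \<in> U" if "j < m" for j
      using bij_betw_apply[OF ms] that PM by (auto simp: m_def)
    have psinj: "ps i = ps i' \<longleftrightarrow> i = i'" if "i < q" "i' < q" for i i'
      using ps that by (auto simp: q_def bij_betw_def inj_on_def)
    have msinj: "ms i = ms i' \<longleftrightarrow> i = i'" if "i < m" "i' < m" for i i'
      using ms that by (auto simp: m_def bij_betw_def inj_on_def)
    have Y1: "(\<Sum>j<m. Y j i * Y j i') = (if i = i' then 1 else 0)"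
      and Y2: "(\<Sum>j<m. t (ms j) * (Y j i * Y j i')) = (if i = i' then t (ps i) else 0)" if "i < q" "i' < q" for i i'
      using Y that unfolding cM[symmetric] q_def m_def by blast+
    have pm: "a (ps i) (ms j) = 0" "a (ms j) (ps i) = 0" if "i < q" "j < m" for i j
      using that psP msM PM(3) orth by (metis disjoint_iff)+
    define r where "r u = Re (\<omega> * a u u)" for u
    define \<alpha> where "\<alpha> i = 1 / sqrt (r (ps i))" for i
    define \<beta> where "\<beta> j i = Y j i / sqrt (- r (ms j))" for j i
    define y where "y i = (\<Sum>j<m. of_real (\<beta> j i) \<star> ms j)" for i
    define x where "x i = of_real (\<alpha> i) \<star> ps i + y i" for i
    have py: "a (ps i) (y i') = 0" "a (y i') (ps i) = 0" if "i < q" for i i'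
      unfolding y_def sum_left sum_right using pm that by auto
    have yy: "\<omega> * a (y i) (y i') = - (if i = i' then Complex 1 (t (ps i)) else 0)" if i: "i < q" "i' < q" for i i'
    proof -
      have "a (y i) (y i') = (\<Sum>j<m. of_real (\<beta> j i) * (\<Sum>j'<m. of_real (\<beta> j' i') * a (ms j) (ms j')))"
        unfolding y_def sum_left by (simp add: sum_right)
      also have "\<dots> = (\<Sum>j<m. of_real (\<beta> j i) * (\<Sum>j'<m. if j' = j then of_real (\<beta> j i') * a (ms j) (ms j) else 0))"
        by (intro sum.cong refl arg_cong2[where f = "(*)"]) (use msM msinj orth in auto)
      also have "\<dots> = (\<Sum>j<m. of_real (\<beta> j i * \<beta> j i') * a (ms j) (ms j))"
        by (intro sum.cong refl) simp
      finally have "\<omega> * a (y i) (y i') = (\<Sum>j<m. of_real (\<beta> j i * \<beta> j i') * (\<omega> * a (ms j) (ms j)))"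
        by (simp add: sum_distrib_left mult.left_commute)
      also have "\<dots> = (\<Sum>j<m. - (of_real (Y j i * Y j i') * Complex 1 (t (ms j))))"
      proof (intro sum.cong refl)
        fix j assume "j \<in> {..<m}"
        then have j: "j < m" by simp
        have rn: "r (ms j) < 0" using Mneg msM(1)[OF j] by (simp add: r_def)
        have "\<beta> j i * \<beta> j i' = Y j i * Y j i' / (- r (ms j))" using rn by (simp add: \<beta>_def)
        then have b: "\<beta> j i * \<beta> j i' * r (ms j) = - (Y j i * Y j i')" using rn by simp
        have "of_real (\<beta> j i * \<beta> j i') * (\<omega> * a (ms j) (ms j)) = of_real (\<beta> j i * \<beta> j i' * r (ms j)) * Complex 1 (t (ms j))"
          using form[OF msM(2)[OF j]] unfolding r_def[symmetric] by (simp only: of_real_mult mult.assoc)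
        then show "of_real (\<beta> j i * \<beta> j i') * (\<omega> * a (ms j) (ms j)) = - (of_real (Y j i * Y j i') * Complex 1 (t (ms j)))"
          unfolding b by simp
      qed
      also have "\<dots> = - Complex (\<Sum>j<m. Y j i * Y j i') (\<Sum>j<m. t (ms j) * (Y j i * Y j i'))"
        by (simp add: complex_eq_iff sum_negf mult.commute)
      also have "\<dots> = - (if i = i' then Complex 1 (t (ps i)) else 0)"
        unfolding Y1[OF i] Y2[OF i] by (simp add: complex_eq_iff)
      finally show ?thesis .
    qed
    have pp: "\<omega> * (of_real (\<alpha> i) * (of_real (\<alpha> i') * a (ps i) (ps i'))) = (if i = i' then Complex 1 (t (ps i)) else 0)"
      if i: "i < q" "i' < q" for i i'
    proof (cases "i = i'")
      case True
      have rn: "r (ps i) > 0" using Ppos psP(1)[OF i(1)] by (simp add: r_def)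
      then have al: "\<alpha> i * \<alpha> i * r (ps i) = 1" by (simp add: \<alpha>_def)
      have "\<omega> * (of_real (\<alpha> i) * (of_real (\<alpha> i) * a (ps i) (ps i))) = of_real (\<alpha> i * \<alpha> i) * (\<omega> * a (ps i) (ps i))"
        by (simp add: mult_ac)
      also have "\<dots> = of_real (\<alpha> i * \<alpha> i * r (ps i)) * Complex 1 (t (ps i))"
        using form[OF psP(2)[OF i(1)]] unfolding r_def[symmetric] by (simp only: of_real_mult mult.assoc)
      also have "\<dots> = Complex 1 (t (ps i))" unfolding al by simp
      finally show ?thesis unfolding True[symmetric] if_P[OF refl] .
    next
      case False
      then show ?thesis using orth[OF psP(2)[OF i(1)] psP(2)[OF i(2)]] psinj[OF i] by simp
    qed
    have xx: "a (x i) (x i') = 0" if i: "i < q" "i' < q" for i i'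
    proof -
      have "a (x i) (x i') = of_real (\<alpha> i) * (of_real (\<alpha> i') * a (ps i) (ps i')) + a (y i) (y i')"
        using py i by (simp add: x_def add_left add_right scale_left scale_right)
      then have "\<omega> * a (x i) (x i') = 0" using pp[OF i] yy[OF i] by (simp add: distrib_left)
      then show ?thesis using w by simp
    qed
    have dual: "a (ps i) (x i') = of_real (\<alpha> i') * a (ps i) (ps i')" if "i < q" for i i'
      using py[OF that] by (simp add: x_def add_right scale_right)
    have al0: "\<alpha> i \<noteq> 0" if "i < q" for i using Ppos psP(1)[OF that] by (force simp: \<alpha>_def r_def)
    have kq: "i < q" if "i < k" for i using that k by (simp add: q_def)
    have off: "a (ps i) (x j) = 0" if "i \<in> {..<k}" "j \<in> {..<k}" "i \<noteq> j" for i j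
      using that dual kq psinj psP orth by simp
    have diag: "a (ps i) (x i) \<noteq> 0" if "i \<in> {..<k}" for i
      using that dual kq al0 nz psP by simp
    note ind = independent_dual[of "{..<k}" "\<lambda>i. a (ps i)" x, OF finite_lessThan functional_right diag off]
    show ?thesis
    proof (intro exI[of _ "x ` {..<k}"] conjI)
      show "card (x ` {..<k}) = k" using card_image[OF ind(1)] by simp
      show "independent (x ` {..<k})" by (rule ind(2))
      show "x ` {..<k} \<subseteq> span U"
      proof -
        have "y i \<in> span U" for i
          unfolding y_def by (intro span_sum span_scale span_base) (use msM in auto)
        then have "x i \<in> span U" if "i < q" for i
          unfolding x_def using span_base[OF psP(2)[OF that]] by (intro span_add span_scale)
        then show ?thesis using kq by auto
      qed
      show "\<forall>z\<in>x ` {..<k}. \<forall>z'\<in>x ` {..<k}. a z z' = 0" using xx kq by auto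
    qed simp
  qed
qed (fact U nz anti F depth)+

text \<open>
  Induction on the dimension.  In the diagonal case two values with \<open>a u u = - \<rho> a v v\<close> are impossible,
  because \<open>u + sqrt \<rho> v\<close> would be an isotropic pencil eigenvector; and the basis vectors with
  \<open>Re (\<omega> a u u) < 0\<close> span a negative definite subspace, which turns the index condition into one on the
  number of such basis vectors.
\<close>
theorem isotropic_subspace_exists:
  assumes "finite B" "independent B" "generic_depth B k"
  shows "\<exists>R. finite R \<and> independent R \<and> card R = k \<and> R \<subseteq> span B \<and> (\<forall>x\<in>R. \<forall>y\<in>R. a x y = 0)"
  using assms
proof (induction "card B" arbitrary: B k rule: less_induct)
  case less
  show ?case
  proof (cases k)
    case 0
    then show ?thesis by (intro exI[of _ "{}"]) (simp add: independent_empty)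
  next
    case (Suc k')
    show ?thesis
    proof (cases "\<exists>u. pencil_eigenvector (span B) u \<and> a u u = 0")
      case True
      then obtain u where u: "pencil_eigenvector (span B) u" "a u u = 0" by blast
      obtain C where C: "finite C" "independent (insert u C)" "u \<notin> C" "span (insert u C) \<subseteq> span B"
        "card C < card B" "\<And>y. y \<in> span (insert u C) \<Longrightarrow> a u y = 0 \<and> a y u = 0" "generic_depth C k'"
        by (rule isotropic_reduction[OF less.prems(1,2) u less.prems(3)[unfolded Suc]]) (rule that; blast)
      have iC: "independent C" using C(2) independent_mono by blast
      obtain R where R: "finite R \<and> independent R \<and> card R = k' \<and> R \<subseteq> span C \<and> (\<forall>x\<in>R. \<forall>y\<in>R. a x y = 0)"
        using less.hyps[OF C(5,1) iC C(7)] ..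
      have RC: "span R \<subseteq> span C" using R by (simp add: span_minimal)
      have uC: "u \<notin> span C" using C(2,3) by (simp add: independent_insert)
      then have uR: "u \<notin> span R" "u \<notin> R" using RC R by blast+
      have Ru: "a u y = 0 \<and> a y u = 0" if "y \<in> R" for y
        using C(6)[of y] that R span_mono[of C "insert u C"] by blast
      show ?thesis
      proof (intro exI[of _ "insert u R"] conjI)
        show "independent (insert u R)" using independent_insertI[OF uR(1)] R by blast
        show "card (insert u R) = k" using R uR Suc by simp
        show "insert u R \<subseteq> span B"
          using u(1) R C(4) span_mono[of C "insert u C"] by (auto simp: pencil_eigenvector_def)
        show "\<forall>x\<in>insert u R. \<forall>y\<in>insert u R. a x y = 0" using R Ru u(2) by auto
      qed (use R in auto)
    next
      case False
      then have ani: "\<And>u. pencil_eigenvector (span B) u \<Longrightarrow> a u u \<noteq> 0" by blast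
      obtain U where U0: "finite U \<and> independent U \<and> span U = span B \<and> card U = card B \<and>
          (\<forall>u\<in>U. \<forall>v\<in>U. u \<noteq> v \<longrightarrow> a u v = 0) \<and> (\<forall>u\<in>U. a u u \<noteq> 0)"
        using orthogonal_basis_exists[OF less.prems(1,2) ani] ..
      then have U: "finite U" "independent U" "span U = span B" "card U = card B"
        and orth: "\<And>u v. u \<in> U \<Longrightarrow> v \<in> U \<Longrightarrow> u \<noteq> v \<Longrightarrow> a u v = 0" and nz: "\<And>u. u \<in> U \<Longrightarrow> a u u \<noteq> 0"
        by auto
      have anti: "a u u \<noteq> - of_real \<rho> * a v v" if uv: "u \<in> U" "v \<in> U" and rho: "\<rho> > 0" for u v \<rho>
      proof
        assume e: "a u u = - of_real \<rho> * a v v"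
        have "u \<noteq> v"
        proof
          assume "u = v"
          then have "(1 + of_real \<rho>) * a u u = 0" using e by (simp add: distrib_right eq_neg_iff_add_eq_0)
          moreover have "1 + complex_of_real \<rho> \<noteq> 0" using rho by (simp add: complex_eq_iff)
          ultimately show False using nz[OF uv(1)] by simp
        qed
        then have o: "a u v = 0" "a v u = 0" using orth uv by auto
        define s where "s = complex_of_real (sqrt \<rho>)"
        have s: "s * s = of_real \<rho>" "cnj s = s" using rho by (simp_all add: s_def flip: of_real_mult)
        define z where "z = u + s \<star> v"
        have zz: "a z z = 0" using o e s
          by (simp add: z_def add_left add_right scale_left scale_right flip: mult.assoc)
        have uz: "a u z = a u u" "a z u = a u u" "a v z = s * a v v" "a z v = s * a v v"
          using o s by (simp_all add: z_def add_left add_right scale_left scale_right)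
        have "z \<noteq> 0" using uz(1) nz[OF uv(1)] by auto
        moreover have "z \<in> span B" unfolding z_def U(3)[symmetric] using uv by (intro span_add span_scale span_base)
        moreover have "cnj (a u u) * a y z + (- a u u) * cnj (a z y) = 0" if y: "y \<in> span B" for y
        proof -
          have fn: "functional (\<lambda>y. a u u * cnj (a y z) - cnj (a u u) * a z y)"
            by (simp add: functional_def add_left add_right scale_left scale_right algebra_simps)
          have "a u u * cnj (a x z) - cnj (a u u) * a z x = 0" if x: "x \<in> U" for x
          proof -
            consider "x = u" | "x = v" | "x \<noteq> u" "x \<noteq> v" by blast
            then show ?thesis
            proof cases
              case 1
              then show ?thesis using uz by (simp add: mult.commute)
            next
              case 2
              have "cnj (a u u) = - of_real \<rho> * cnj (a v v)" using e by simp
              then show ?thesis using 2 uz e s(2) by (simp add: mult_ac)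
            next
              case 3
              then have "a x z = 0" "a z x = 0" using orth x uv
                by (simp_all add: z_def add_left add_right scale_left scale_right)
              then show ?thesis by simp
            qed
          qed
          then have "a u u * cnj (a y z) - cnj (a u u) * a z y = 0"
            using kernel_on_span[OF fn] y U(3) by blast
          then have "cnj (a u u * cnj (a y z) - cnj (a u u) * a z y) = 0" by (simp only: complex_cnj_zero)
          then show ?thesis by simp
        qed
        ultimately have "pencil_eigenvector (span B) z"
          unfolding pencil_eigenvector_def using nz[OF uv(1)] by (metis complex_cnj_zero_iff prod.inject)
        then show False using ani zz by blast
      qed
      obtain F where F: "finite F" "\<And>\<omega> N. cmod \<omega> = 1 \<Longrightarrow> \<omega> \<notin> F \<Longrightarrow> finite N \<Longrightarrow> independent N \<Longrightarrow> N \<subseteq> span B \<Longrightarrow>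
        negative_on \<omega> (span N) \<Longrightarrow> card N + k \<le> card B"
        using less.prems(3) unfolding generic_depth_def by metis
      have depth: "k \<le> card {u \<in> U. Re (\<omega> * a u u) \<ge> 0}" if w: "cmod \<omega> = 1" "\<omega> \<notin> F" for \<omega>
      proof -
        define N where "N = {u \<in> U. Re (\<omega> * a u u) < 0}"
        have N: "finite N" "N \<subseteq> U" using U(1) by (auto simp: N_def)
        have "negative_on \<omega> (span N)" unfolding negative_on_def
        proof (intro ballI impI)
          fix x assume x: "x \<in> span N" "x \<noteq> 0"
          obtain c where c: "x = (\<Sum>u\<in>N. c u \<star> u)" using x(1) span_finite[OF N(1)] by auto
          have "\<exists>v\<in>N. c v \<noteq> 0" using c x(2) by (metis (mono_tags, lifting) scale_zero_left sum.neutral)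
          then obtain v where v: "v \<in> N" "c v \<noteq> 0" by blast
          have "\<omega> * a x x = (\<Sum>u\<in>N. of_real ((cmod (c u))\<^sup>2) * (\<omega> * a u u))"
            unfolding c using orthogonal_norm[OF N(1), of c] orth N(2)
            by (simp add: subset_iff sum_distrib_left mult.left_commute)
          then have "Re (\<omega> * a x x) = (\<Sum>u\<in>N. (cmod (c u))\<^sup>2 * Re (\<omega> * a u u))"
            by (simp only: Re_sum times_complex.sel(1) Re_complex_of_real Im_complex_of_real mult_zero_left diff_zero)
          also have "\<dots> < 0"
          proof -
            have "(\<Sum>u\<in>N. (cmod (c u))\<^sup>2 * Re (\<omega> * a u u)) < (\<Sum>u\<in>N. 0)"
            proof (rule sum_strict_mono_ex1[OF N(1)])
              show "\<forall>u\<in>N. (cmod (c u))\<^sup>2 * Re (\<omega> * a u u) \<le> 0"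
                by (intro ballI mult_nonneg_nonpos) (auto simp: N_def)
              show "\<exists>u\<in>N. (cmod (c u))\<^sup>2 * Re (\<omega> * a u u) < 0"
                using v by (intro bexI[of _ v] mult_pos_neg) (auto simp: N_def)
            qed
            then show ?thesis by simp
          qed
          finally show "Re (\<omega> * a x x) < 0" .
        qed
        moreover have "independent N" using U(2) N(2) independent_mono by blast
        moreover have "N \<subseteq> span B" using N(2) U(3) span_base by blast
        ultimately have "card N + k \<le> card U" using F(2)[OF w N(1)] U(4) by simp
        moreover have "U = N \<union> {u \<in> U. Re (\<omega> * a u u) \<ge> 0}" by (auto simp: N_def)
        then have "card U \<le> card N + card {u \<in> U. Re (\<omega> * a u u) \<ge> 0}" by (metis card_Un_le)
        ultimately show ?thesis by simp
      qed
      show ?thesis using diagonal_isotropic[OF U(1) orth nz anti F(1) depth] U(3) by simp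
    qed
  qed
qed

end

section \<open>The choice of the scalar\<close>

lemma set_of_three:
  assumes "finite S" "S \<noteq> {}" "card S \<le> 3"
  shows "\<exists>x y z. S = {x, y, z}"
proof -
  consider "card S = 1" | "card S = 2" | "card S = 3"
    using assms card_gt_0_iff[of S] by linarith
  then show ?thesis
  proof cases
    case 1
    then obtain x where "S = {x, x, x}" by (auto simp: card_1_singleton_iff)
    then show ?thesis by blast
  next
    case 2
    then obtain x y where "S = {x, y, y}" by (auto simp: card_2_iff)
    then show ?thesis by blast
  next
    case 3
    then show ?thesis by (auto simp: card_3_iff)
  qed
qed

text \<open>
  Helly's theorem covers finitely many half-planes.  The four half-planes for \<open>1\<close>, \<open>-1\<close>, \<open>\<i>\<close> and \<open>-\<i>\<close> cut
  out a bounded rectangle, so compactness extends this to all of them.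
\<close>
lemma halfplane_intersection:
  fixes c :: "complex \<Rightarrow> real"
  assumes three: "\<And>u v w. cmod u = 1 \<Longrightarrow> cmod v = 1 \<Longrightarrow> cmod w = 1 \<Longrightarrow>
     \<exists>\<mu>. Re (u * \<mu>) \<le> c u \<and> Re (v * \<mu>) \<le> c v \<and> Re (w * \<mu>) \<le> c w"
  shows "\<exists>\<mu>. \<forall>\<omega>. cmod \<omega> = 1 \<longrightarrow> Re (\<omega> * \<mu>) \<le> c \<omega>"
proof -
  define H where "H \<omega> = {\<mu>. Re (\<omega> * \<mu>) \<le> c \<omega>}" for \<omega>
  have conv: "convex (H \<omega>)" for \<omega>
  proof -
    have "H \<omega> = {\<mu>. inner (cnj \<omega>) \<mu> \<le> c \<omega>}" by (simp add: H_def inner_complex_def)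
    then show ?thesis by (simp only: convex_halfspace_le)
  qed
  have clos: "closed (H \<omega>)" for \<omega>
    unfolding H_def by (intro closed_Collect_le continuous_intros)
  have finite_case: "\<Inter> (H ` I) \<noteq> {}" if I: "finite I" "I \<noteq> {}" "I \<subseteq> {\<omega>. cmod \<omega> = 1}" for I
  proof -
    have small: "\<Inter> t \<noteq> {}" if t: "t \<subseteq> H ` I" "t \<noteq> {}" "card t \<le> 3" for t
    proof -
      have "finite t" using t(1) I(1) finite_surj by blast
      from set_of_three[OF this t(2,3)] obtain X Y Z where X: "t = {X, Y, Z}" by metis
      then have "X \<in> H ` I" "Y \<in> H ` I" "Z \<in> H ` I" using t(1) by auto
      then obtain u v w where "u \<in> I" "v \<in> I" "w \<in> I" "X = H u" "Y = H v" "Z = H w" by auto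
      then show ?thesis using three[of u v w] I(3) X by (auto simp: H_def)
    qed
    show ?thesis
    proof (cases "card (H ` I) \<le> 3")
      case True
      then show ?thesis using small[of "H ` I"] I(2) by blast
    next
      case False
      have sm: "\<Inter> t \<noteq> {}" if t: "t \<subseteq> H ` I" "card t = DIM(complex) + 1" for t
        using small[OF t(1)] t(2) by (cases "t = {}") auto
      show ?thesis
        by (rule Helly) (use False conv sm in auto)
    qed
  qed
  \<comment> \<open>\<open>K\<close> is the bounding rectangle.\<close>
  define Q :: "complex set" where "Q = {1, -1, \<i>, -\<i>}"
  define K where "K = \<Inter> (H ` Q)"
  have "compact K"
  proof -
    define f where "f p = Complex (fst p) (snd p)" for p
    have f: "f = (\<lambda>p. of_real (fst p) + \<i> * of_real (snd p))"
      by (auto simp: f_def complex_eq_iff)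
    have "compact (f ` ({- c (-1)..c 1} \<times> {- c \<i>..c (-\<i>)}))"
      unfolding f by (intro compact_continuous_image continuous_intros compact_Times compact_Icc)
    moreover have "K \<subseteq> f ` ({- c (-1)..c 1} \<times> {- c \<i>..c (-\<i>)})"
    proof
      fix z assume "z \<in> K"
      then have "z = f (Re z, Im z)" "(Re z, Im z) \<in> {- c (-1)..c 1} \<times> {- c \<i>..c (-\<i>)}"
        by (auto simp: K_def Q_def H_def f_def)
      then show "z \<in> f ` ({- c (-1)..c 1} \<times> {- c \<i>..c (-\<i>)})" by blast
    qed
    moreover have "closed K" unfolding K_def using clos by auto
    ultimately show ?thesis using compact_Int_closed[of _ K] by (metis inf.absorb_iff2 inf_commute)
  qed
  then have "K \<inter> \<Inter> (H ` {\<omega>. cmod \<omega> = 1}) \<noteq> {}"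
  proof (rule compact_imp_fip)
    fix T assume "T \<in> H ` {\<omega>. cmod \<omega> = 1}"
    then show "closed T" using clos by auto
  next
    fix F assume F: "finite F" "F \<subseteq> H ` {\<omega>. cmod \<omega> = 1}"
    then obtain I where I: "I \<subseteq> {\<omega>. cmod \<omega> = 1}" "finite I" "F = H ` I" using finite_subset_image by metis
    have "\<Inter> (H ` (Q \<union> I)) \<noteq> {}"
      by (rule finite_case) (use I in \<open>auto simp: Q_def\<close>)
    then show "K \<inter> \<Inter> F \<noteq> {}" unfolding K_def I(3) image_Un Inter_Un_distrib .
  qed
  then show ?thesis by (auto simp: H_def)
qed

context sesquilinear_form
begin

text \<open>
  The Courant-Fischer principle, with subspaces given by equations: \<open>c\<close> is the \<open>k\<close>-th largest eigenvalue
  of the Hermitian part of \<open>\<omega> a\<close> relative to the inner product \<open>ip\<close>.  The eigenvectors come from the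
  orthogonal basis for the form \<open>f\<close> whose Hermitian part is that of \<open>\<omega> a\<close> and whose skew-Hermitian part
  is \<open>\<i> ip\<close>; orthogonality for \<open>f\<close> is orthogonality for both parts.
\<close>
lemma eigenvalue_cut:
  assumes ip: "sesquilinear_form scale ip" "\<And>x y. ip y x = cnj (ip x y)"
    and B: "finite B" "independent B" and pos: "\<And>x. x \<in> span B \<Longrightarrow> x \<noteq> 0 \<Longrightarrow> Re (ip x x) > 0"
    and k: "0 < k" "k \<le> card B"
  shows "\<exists>c \<Phi> \<Psi>. finite \<Phi> \<and> finite \<Psi> \<and> card \<Phi> < k \<and> card \<Psi> + k \<le> card B \<and> (\<forall>\<phi>\<in>\<Phi>\<union>\<Psi>. functional \<phi>) \<and>
     (\<forall>x\<in>span B. (\<forall>\<phi>\<in>\<Phi>. \<phi> x = 0) \<longrightarrow> Re (\<omega> * a x x) \<le> c * Re (ip x x)) \<and>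
     (\<forall>x\<in>span B. (\<forall>\<phi>\<in>\<Psi>. \<phi> x = 0) \<longrightarrow> c * Re (ip x x) \<le> Re (\<omega> * a x x))"
proof -
  interpret ip: sesquilinear_form scale ip by fact
  define f where "f x y = (\<omega> * a x y + cnj (\<omega> * a y x)) / 2 + \<i> * ip x y" for x y
  interpret f: sesquilinear_form scale f
    by unfold_locales (simp_all add: f_def add_left add_right scale_left scale_right ip.add_left ip.add_right
        ip.scale_left ip.scale_right field_simps)
  have f_diag: "Re (f x x) = Re (\<omega> * a x x)" "Im (f x x) = Re (ip x x)" for x
  proof -
    have "Im (ip x x) = 0" using arg_cong[OF ip(2)[of x x], of Im] by simp
    then show "Re (f x x) = Re (\<omega> * a x x)" "Im (f x x) = Re (ip x x)" by (simp_all add: f_def)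
  qed
  have "f x x \<noteq> 0" if "f.pencil_eigenvector (span B) x" for x
    using that pos[of x] f_diag(2)[of x] by (auto simp: f.pencil_eigenvector_def)
  then obtain U where U0: "finite U \<and> independent U \<and> span U = span B \<and> card U = card B \<and>
      (\<forall>u\<in>U. \<forall>v\<in>U. u \<noteq> v \<longrightarrow> f u v = 0) \<and> (\<forall>u\<in>U. f u u \<noteq> 0)"
    using f.orthogonal_basis_exists[OF B] by blast
  then have U: "finite U" "span U = span B" "card U = card B"
    and orth: "\<And>u v. u \<in> U \<Longrightarrow> v \<in> U \<Longrightarrow> u \<noteq> v \<Longrightarrow> f u v = 0" and nz: "\<And>u. u \<in> U \<Longrightarrow> f u u \<noteq> 0"
    by auto
  define g where "g u = Re (ip u u)" for u
  define h where "h u = Re (\<omega> * a u u)" for u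
  have g: "g u > 0" if "u \<in> U" for u
  proof -
    have "u \<noteq> 0" using nz[OF that] by auto
    then show ?thesis using pos[of u] span_base[OF that] U(2) by (simp add: g_def)
  qed
  have fu: "f u u = Complex (h u) (g u)" for u by (simp add: complex_eq_iff f_diag g_def h_def)
  have expand: "\<exists>w. (\<forall>u\<in>U. 0 \<le> w u) \<and> (\<forall>u\<in>U. f u x = 0 \<longrightarrow> w u = 0) \<and>
      Re (\<omega> * a x x) = (\<Sum>u\<in>U. w u * h u) \<and> Re (ip x x) = (\<Sum>u\<in>U. w u * g u)" if "x \<in> span B" for x
  proof -
    define cc where "cc u = f u x / f u u" for u
    have x: "x = (\<Sum>u\<in>U. cc u \<star> u)"
      unfolding cc_def using f.orthogonal_expansion[OF U(1) orth nz] that U(2) by blast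
    have e: "f x x = (\<Sum>u\<in>U. of_real ((cmod (cc u))\<^sup>2) * Complex (h u) (g u))"
      using f.orthogonal_norm[OF U(1) orth, of cc] unfolding x[symmetric] fu .
    have "Re (\<omega> * a x x) = (\<Sum>u\<in>U. (cmod (cc u))\<^sup>2 * h u)" "Re (ip x x) = (\<Sum>u\<in>U. (cmod (cc u))\<^sup>2 * g u)"
      unfolding f_diag(1)[of x, symmetric] f_diag(2)[of x, symmetric] e by (simp_all del: of_real_power)
    moreover have "(cmod (cc u))\<^sup>2 = 0" if "f u x = 0" for u using that by (simp add: cc_def)
    ultimately show ?thesis by (intro exI[of _ "\<lambda>u. (cmod (cc u))\<^sup>2"]) auto
  qed
  obtain us where us0: "bij_betw us {..<card U} U \<and> (\<forall>j<card U. \<forall>i\<le>j. h (us i) / g (us i) \<le> h (us j) / g (us j))"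
    using sorted_enumeration[OF U(1), of "\<lambda>u. h u / g u"] by blast
  define n where "n = card U"
  have us: "bij_betw us {..<n} U" "\<And>i j. i \<le> j \<Longrightarrow> j < n \<Longrightarrow> h (us i) / g (us i) \<le> h (us j) / g (us j)"
    using us0 by (auto simp: n_def)
  have usU: "us i \<in> U" if "i < n" for i using bij_betw_apply[OF us(1)] that by simp
  define c where "c = h (us (n - k)) / g (us (n - k))"
  have kn: "n - k < n" using k U(3) by (simp add: n_def)
  have low: "h (us i) \<le> c * g (us i)" if "i \<le> n - k" for i
    using us(2)[OF that kn] g[OF usU[of i]] that kn by (simp add: c_def pos_divide_le_eq)
  have high: "c * g (us i) \<le> h (us i)" if "n - k \<le> i" "i < n" for i
    using us(2)[OF that] g[OF usU[of i]] that by (simp add: c_def pos_le_divide_eq)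
  define \<Phi> where "\<Phi> = (\<lambda>i. f (us i)) ` {n - k<..<n}"
  define \<Psi> where "\<Psi> = (\<lambda>i. f (us i)) ` {..<n - k}"
  have sum_le: "(\<Sum>u\<in>U. w u * p u) \<le> (\<Sum>u\<in>U. w u * p' u)"
    if "\<And>i. i < n \<Longrightarrow> w (us i) = 0 \<or> p (us i) \<le> p' (us i)" "\<forall>u\<in>U. 0 \<le> w u" for w p p' :: "'v \<Rightarrow> real"
  proof (rule sum_mono)
    fix u assume u: "u \<in> U"
    then obtain i where i: "i < n" "u = us i" using us(1) by (auto simp: bij_betw_def)
    show "w u * p u \<le> w u * p' u" using that(1)[OF i(1)] that(2) u i(2) by (auto intro: mult_left_mono)
  qed
  show ?thesis
  proof (rule exI[of _ c], rule exI[of _ \<Phi>], rule exI[of _ \<Psi>], intro conjI ballI impI)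
    show "finite \<Phi>" "finite \<Psi>" by (auto simp: \<Phi>_def \<Psi>_def)
    have "card \<Phi> \<le> card {n - k<..<n}" unfolding \<Phi>_def by (intro card_image_le) auto
    then show "card \<Phi> < k" using k U(3) by (simp add: n_def)
    have "card \<Psi> \<le> card {..<n - k}" unfolding \<Psi>_def by (intro card_image_le) auto
    then show "card \<Psi> + k \<le> card B" using k U(3) by (simp add: n_def)
    show "functional \<phi>" if "\<phi> \<in> \<Phi> \<union> \<Psi>" for \<phi>
      using that f.functional_right by (auto simp: \<Phi>_def \<Psi>_def)
  next
    fix x assume x: "x \<in> span B" "\<forall>\<phi>\<in>\<Phi>. \<phi> x = 0"
    obtain w where w: "\<forall>u\<in>U. 0 \<le> w u" "\<forall>u\<in>U. f u x = 0 \<longrightarrow> w u = 0"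
      "Re (\<omega> * a x x) = (\<Sum>u\<in>U. w u * h u)" "Re (ip x x) = (\<Sum>u\<in>U. w u * g u)"
      using expand[OF x(1)] by blast
    have "(\<Sum>u\<in>U. w u * h u) \<le> (\<Sum>u\<in>U. w u * (c * g u))"
    proof (rule sum_le[OF _ w(1)])
      fix i assume i: "i < n"
      show "w (us i) = 0 \<or> h (us i) \<le> c * g (us i)"
        using low[of i] x(2) w(2) i usU[OF i] by (cases "i \<le> n - k") (auto simp: \<Phi>_def)
    qed
    then show "Re (\<omega> * a x x) \<le> c * Re (ip x x)" unfolding w(3,4) by (simp add: sum_distrib_left mult.left_commute)
  next
    fix x assume x: "x \<in> span B" "\<forall>\<phi>\<in>\<Psi>. \<phi> x = 0"
    obtain w where w: "\<forall>u\<in>U. 0 \<le> w u" "\<forall>u\<in>U. f u x = 0 \<longrightarrow> w u = 0"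
      "Re (\<omega> * a x x) = (\<Sum>u\<in>U. w u * h u)" "Re (ip x x) = (\<Sum>u\<in>U. w u * g u)"
      using expand[OF x(1)] by blast
    have "(\<Sum>u\<in>U. w u * (c * g u)) \<le> (\<Sum>u\<in>U. w u * h u)"
    proof (rule sum_le[OF _ w(1)])
      fix i assume i: "i < n"
      show "w (us i) = 0 \<or> c * g (us i) \<le> h (us i)"
        using high[of i] x(2) w(2) i usU[OF i] by (cases "i < n - k") (auto simp: \<Psi>_def)
    qed
    then show "c * Re (ip x x) \<le> Re (\<omega> * a x x)" unfolding w(3,4) by (simp add: sum_distrib_left mult.left_commute)
  qed
qed

theorem scalar_compression_exists:
  assumes ip: "sesquilinear_form scale ip" "\<And>x y. ip y x = cnj (ip x y)"
    and B: "finite B" "independent B" and pos: "\<And>x. x \<in> span B \<Longrightarrow> x \<noteq> 0 \<Longrightarrow> Re (ip x x) > 0"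
    and k: "0 < k" "3 * (k - 1) < card B" "k \<le> card B"
  shows "\<exists>\<mu> U. finite U \<and> card U = k \<and> U \<subseteq> span B \<and> 0 \<notin> U \<and> (\<forall>u\<in>U. \<forall>v\<in>U. u \<noteq> v \<longrightarrow> ip u v = 0) \<and>
     (\<forall>u\<in>U. \<forall>v\<in>U. a u v = \<mu> * ip u v)"
proof -
  interpret ip: sesquilinear_form scale ip by fact
  define cut where "cut \<omega> c \<Phi> \<Psi> \<longleftrightarrow> finite \<Phi> \<and> finite \<Psi> \<and> card \<Phi> < k \<and> card \<Psi> + k \<le> card B \<and> (\<forall>\<phi>\<in>\<Phi>\<union>\<Psi>. functional \<phi>) \<and>
     (\<forall>x\<in>span B. (\<forall>\<phi>\<in>\<Phi>. \<phi> x = 0) \<longrightarrow> Re (\<omega> * a x x) \<le> c * Re (ip x x)) \<and>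
     (\<forall>x\<in>span B. (\<forall>\<phi>\<in>\<Psi>. \<phi> x = 0) \<longrightarrow> c * Re (ip x x) \<le> Re (\<omega> * a x x))" for \<omega> c \<Phi> \<Psi>
  have "\<exists>c \<Phi> \<Psi>. cut \<omega> c \<Phi> \<Psi>" for \<omega>
    using eigenvalue_cut[OF ip B pos k(1,3), of \<omega>] unfolding cut_def .
  then have "\<forall>\<omega>. \<exists>c. \<exists>\<Phi> \<Psi>. cut \<omega> c \<Phi> \<Psi>" by blast
  from choice[OF this] obtain c where c: "\<forall>\<omega>. \<exists>\<Phi> \<Psi>. cut \<omega> (c \<omega>) \<Phi> \<Psi>" ..
  have ip_real: "ip x x = of_real (Re (ip x x))" for x
    using arg_cong[OF ip(2)[of x x], of Im] by (simp add: complex_eq_iff)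
  have "\<exists>\<mu>. \<forall>\<omega>. cmod \<omega> = 1 \<longrightarrow> Re (\<omega> * \<mu>) \<le> c \<omega>"
  proof (rule halfplane_intersection)
    fix u v w :: complex
    obtain \<Phi>1 \<Psi>1 where 1: "cut u (c u) \<Phi>1 \<Psi>1" using c by blast
    obtain \<Phi>2 \<Psi>2 where 2: "cut v (c v) \<Phi>2 \<Psi>2" using c by blast
    obtain \<Phi>3 \<Psi>3 where 3: "cut w (c w) \<Phi>3 \<Psi>3" using c by blast
    have "card (\<Phi>1 \<union> \<Phi>2 \<union> \<Phi>3) \<le> card \<Phi>1 + card \<Phi>2 + card \<Phi>3"
      by (meson add_le_mono1 card_Un_le order.trans)
    also have "\<dots> \<le> 3 * (k - 1)" using 1 2 3 unfolding cut_def by linarith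
    finally have "card (\<Phi>1 \<union> \<Phi>2 \<union> \<Phi>3) < card B" using k(2) by simp
    moreover have "finite (\<Phi>1 \<union> \<Phi>2 \<union> \<Phi>3)" "\<And>\<phi>. \<phi> \<in> \<Phi>1 \<union> \<Phi>2 \<union> \<Phi>3 \<Longrightarrow> functional \<phi>"
      using 1 2 3 unfolding cut_def by blast+
    ultimately obtain x where x: "x \<in> span B" "x \<noteq> 0" "\<forall>\<phi>\<in>\<Phi>1 \<union> \<Phi>2 \<union> \<Phi>3. \<phi> x = 0"
      using common_zero[OF _ _ B] by meson
    have px: "Re (ip x x) > 0" using pos x by blast
    have quot: "Re (\<omega> * (a x x / ip x x)) = Re (\<omega> * a x x) / Re (ip x x)" for \<omega>
      by (subst ip_real) (simp add: Re_divide_of_real)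
    have "Re (u * a x x) \<le> c u * Re (ip x x)" "Re (v * a x x) \<le> c v * Re (ip x x)" "Re (w * a x x) \<le> c w * Re (ip x x)"
      using 1 2 3 x unfolding cut_def by blast+
    then show "\<exists>\<mu>. Re (u * \<mu>) \<le> c u \<and> Re (v * \<mu>) \<le> c v \<and> Re (w * \<mu>) \<le> c w"
      using px by (intro exI[of _ "a x x / ip x x"]) (simp only: quot pos_divide_le_eq)
  qed
  then obtain \<mu> where mu: "\<forall>\<omega>. cmod \<omega> = 1 \<longrightarrow> Re (\<omega> * \<mu>) \<le> c \<omega>" ..
  define b where "b x y = a x y - \<mu> * ip x y" for x y
  interpret b: sesquilinear_form scale b
    by unfold_locales (simp_all add: b_def add_left add_right scale_left scale_right ip.add_left ip.add_right
        ip.scale_left ip.scale_right algebra_simps)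
  \<comment> \<open>A negative definite subspace of dimension exceeding \<open>card \<Psi>\<close> would contain a common zero of \<open>\<Psi>\<close>, on which \<open>b\<close> is not negative.\<close>
  have "b.generic_depth B k" unfolding b.generic_depth_def
  proof (intro exI[of _ "{}"] conjI allI impI)
    fix \<omega> N assume w: "cmod \<omega> = 1" and N: "finite N" "independent N" "N \<subseteq> span B" "b.negative_on \<omega> (span N)"
    obtain \<Phi> \<Psi> where cut: "cut \<omega> (c \<omega>) \<Phi> \<Psi>" using c by blast
    have "card N \<le> card \<Psi>"
    proof (rule ccontr)
      assume "\<not> card N \<le> card \<Psi>"
      then obtain x where x: "x \<in> span N" "x \<noteq> 0" "\<forall>\<phi>\<in>\<Psi>. \<phi> x = 0"
        using common_zero[of \<Psi> N] N cut unfolding cut_def by (meson UnI2 not_le)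
      have xB: "x \<in> span B" using x(1) N(3) span_minimal[OF _ subspace_span] by blast
      have "c \<omega> * Re (ip x x) \<le> Re (\<omega> * a x x)" using cut xB x(3) unfolding cut_def by blast
      moreover have "Re (\<omega> * \<mu>) * Re (ip x x) \<le> c \<omega> * Re (ip x x)"
        using mu w pos[OF xB x(2)] by (intro mult_right_mono) auto
      moreover have "Re (\<omega> * b x x) = Re (\<omega> * a x x) - Re (\<omega> * \<mu>) * Re (ip x x)"
      proof -
        have "\<omega> * b x x = \<omega> * a x x - (\<omega> * \<mu>) * of_real (Re (ip x x))"
          unfolding b_def by (subst ip_real) (simp add: algebra_simps)
        then show ?thesis by (simp only: minus_complex.sel times_complex.sel(1)[of "\<omega> * \<mu>"] Re_complex_of_real Im_complex_of_real mult_zero_right diff_zero)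
      qed
      moreover have "Re (\<omega> * b x x) < 0" using N(4) x unfolding b.negative_on_def by blast
      ultimately show False by linarith
    qed
    then show "card N + k \<le> card B" using cut unfolding cut_def by linarith
  qed simp
  then obtain R where R: "finite R \<and> independent R \<and> card R = k \<and> R \<subseteq> span B \<and> (\<forall>x\<in>R. \<forall>y\<in>R. b x y = 0)"
    using b.isotropic_subspace_exists[OF B] by blast
  have iso: "b x y = 0" if "x \<in> span R" "y \<in> span R" for x y
  proof -
    have "b z y = 0" if "z \<in> R" for z
      using kernel_on_span[OF b.functional_right[of z] _ \<open>y \<in> span R\<close>] R that by blast
    then have "cnj (b x y) = 0"
      using kernel_on_span[OF b.functional_left[of y] _ \<open>x \<in> span R\<close>] by (metis complex_cnj_zero)
    then show ?thesis by simp
  qed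
  have RB: "span R \<subseteq> span B" using R by (intro span_minimal) auto
  have "ip x x \<noteq> 0" if "ip.pencil_eigenvector (span R) x" for x
    using that pos[of x] RB by (force simp: ip.pencil_eigenvector_def)
  then obtain U where U: "finite U \<and> independent U \<and> span U = span R \<and> card U = card R \<and>
      (\<forall>u\<in>U. \<forall>v\<in>U. u \<noteq> v \<longrightarrow> ip u v = 0) \<and> (\<forall>u\<in>U. ip u u \<noteq> 0)"
    using ip.orthogonal_basis_exists[of R] R by blast
  then have UR: "U \<subseteq> span R" using span_superset by blast
  show ?thesis
  proof (intro exI[of _ \<mu>] exI[of _ U] conjI)
    show "0 \<notin> U" using U ip.zero_left by blast
    show "\<forall>u\<in>U. \<forall>v\<in>U. a u v = \<mu> * ip u v" using iso UR by (auto simp: b_def)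
  qed (use U R UR RB in auto)
qed

end

section \<open>Higher rank numerical ranges of matrices\<close>

text \<open>
  Column vectors of length \<open>n\<close> are modelled as sequences supported in \<open>{..<n}\<close>, since the abstract theory
  needs a type that is a complex vector space.
\<close>
definition pointwise_scale :: "complex \<Rightarrow> (nat \<Rightarrow> complex) \<Rightarrow> nat \<Rightarrow> complex" where
  "pointwise_scale c x = (\<lambda>i. c * x i)"

interpretation sequences: complex_vector_space pointwise_scale
  by unfold_locales (auto simp: pointwise_scale_def fun_eq_iff algebra_simps)

lemma index_mult_mat_sum:
  assumes "P \<in> carrier_mat p q" "Q \<in> carrier_mat q r" "i < p" "j < r"
  shows "(P * Q) $$ (i, j) = (\<Sum>l<q. P $$ (i, l) * Q $$ (l, j))"
  using assms by (simp add: scalar_prod_def atLeast0LessThan)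

theorem theorem1:
  fixes n k :: nat and A :: "complex mat"
  assumes "n > 0"
    and "A \<in> carrier_mat n n"
    and "k > 0"
    and "real k < real n / 3 + 1"
  shows "rank_numerical_range k A \<noteq> {}"
proof -
  have kn: "3 * (k - 1) < n" "k \<le> n" using assms by linarith+
  define a where "a x y = (\<Sum>i<n. \<Sum>j<n. cnj (x i) * A $$ (i, j) * y j)" for x y
  define ip where "ip x y = (\<Sum>i<n. cnj (x i) * y i)" for x y :: "nat \<Rightarrow> complex"
  interpret a: sesquilinear_form pointwise_scale a
    by unfold_locales (simp_all add: a_def pointwise_scale_def algebra_simps sum.distrib sum_distrib_left)
  interpret ip: sesquilinear_form pointwise_scale ip
    by unfold_locales (simp_all add: ip_def pointwise_scale_def algebra_simps sum.distrib sum_distrib_left)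
  have ip_herm: "ip y x = cnj (ip x y)" for x y by (simp add: ip_def mult.commute)
  define e where "e i = (\<lambda>j. if j = i then 1 else 0 :: complex)" for i :: nat
  have eval: "sequences.functional (\<lambda>x. x i)" for i
    by (simp add: sequences.functional_def pointwise_scale_def)
  define B where "B = e ` {..<n}"
  have indB: "inj_on e {..<n}" "sequences.independent B"
    unfolding B_def using sequences.independent_dual[of "{..<n}" "\<lambda>i x. x i" e] eval by (simp_all add: e_def)
  have finB: "finite B" and cardB: "card B = n" using card_image[OF indB(1)] by (simp_all add: B_def)
  have support: "x i = 0" if "x \<in> sequences.span B" "\<not> i < n" for x i
    by (rule sequences.kernel_on_span[OF eval _ that(1)]) (use that(2) in \<open>auto simp: B_def e_def\<close>)
  have ip_self: "ip x x = of_real (\<Sum>i<n. (cmod (x i))\<^sup>2)" for x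
    unfolding ip_def of_real_sum complex_norm_square by (simp add: mult.commute)
  have pos: "Re (ip x x) > 0" if x: "x \<in> sequences.span B" "x \<noteq> 0" for x
  proof -
    obtain i where "x i \<noteq> 0" using x(2) by (auto simp: fun_eq_iff)
    then have "(\<Sum>i<n. (cmod (x i))\<^sup>2) > 0"
      using support[OF x(1)] by (intro sum_pos2[of _ i]) auto
    then show ?thesis by (simp add: ip_self)
  qed
  obtain \<mu> U where U: "finite U" "card U = k" "U \<subseteq> sequences.span B" "0 \<notin> U"
     "\<And>u v. u \<in> U \<Longrightarrow> v \<in> U \<Longrightarrow> u \<noteq> v \<Longrightarrow> ip u v = 0" "\<And>u v. u \<in> U \<Longrightarrow> v \<in> U \<Longrightarrow> a u v = \<mu> * ip u v"
    using a.scalar_compression_exists[OF ip.sesquilinear_form_axioms ip_herm finB indB(2) pos assms(3)] kn cardB by metis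
  obtain us where us: "bij_betw us {..<k} U" using ex_bij_betw_nat_finite[OF U(1)] U(2) by (auto simp: atLeast0LessThan)
  have usU: "us j \<in> U" if "j < k" for j using bij_betw_apply[OF us] that by simp
  define s where "s j = complex_of_real (sqrt (Re (ip (us j) (us j))))" for j
  have s: "cnj (s j) = s j" "s j \<noteq> 0" "s j * s j = ip (us j) (us j)" if "j < k" for j
  proof -
    have p: "Re (ip (us j) (us j)) > 0" using pos[of "us j"] usU[OF that] U(3,4) by (metis subsetD)
    then show "cnj (s j) = s j" "s j \<noteq> 0" by (auto simp: s_def)
    have "s j * s j = of_real (Re (ip (us j) (us j)))" using p by (simp add: s_def flip: of_real_mult)
    then show "s j * s j = ip (us j) (us j)" by (simp add: ip_self)
  qed
  \<comment> \<open>The columns are the vectors of \<open>U\<close>, normalised with respect to \<open>ip\<close>.\<close>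
  define X where "X = mat n k (\<lambda>(i, j). us j i / s j)"
  have X: "X \<in> carrier_mat n k" by (simp add: X_def)
  have X_entry: "X $$ (l, j) = us j l / s j" if "l < n" "j < k" for l j using that by (simp add: X_def)
  have adjX: "mat_adjoint X \<in> carrier_mat k n"
    using X by (auto simp: mat_adjoint_def)
  have adj: "mat_adjoint X $$ (i, l) = cnj (us i l) / s i" if "i < k" "l < n" for i l
    using that s(1)[OF that(1)] by (simp add: mat_adjoint_def mat_of_rows_def X_def cols_def conjugate_complex_def)
  have gram: "ip (us i) (us j) / (s i * s j) = (if i = j then 1 else 0)" if "i < k" "j < k" for i j
  proof (cases "i = j")
    case True
    then show ?thesis using s[OF that(1)] by auto
  next
    case False
    then have "us i \<noteq> us j" using us that by (auto simp: bij_betw_def inj_on_def)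
    then show ?thesis using U(5) usU that False by simp
  qed
  have "mat_adjoint X * X = 1\<^sub>m k"
  proof (rule eq_matI)
    fix i j assume ij: "i < dim_row (1\<^sub>m k :: complex mat)" "j < dim_col (1\<^sub>m k :: complex mat)"
    then have ij: "i < k" "j < k" by simp_all
    have "(mat_adjoint X * X) $$ (i, j) = (\<Sum>l<n. mat_adjoint X $$ (i, l) * X $$ (l, j))"
      by (rule index_mult_mat_sum[OF adjX X ij])
    also have "\<dots> = ip (us i) (us j) / (s i * s j)"
      using ij by (simp add: ip_def adj X_entry sum_divide_distrib)
    finally show "(mat_adjoint X * X) $$ (i, j) = 1\<^sub>m k $$ (i, j)" using gram[OF ij] ij by simp
  qed (use X adjX in auto)
  moreover have "mat_adjoint X * A * X = \<mu> \<cdot>\<^sub>m 1\<^sub>m k"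
  proof (rule eq_matI)
    fix i j assume ij: "i < dim_row (\<mu> \<cdot>\<^sub>m 1\<^sub>m k)" "j < dim_col (\<mu> \<cdot>\<^sub>m 1\<^sub>m k)"
    then have ij: "i < k" "j < k" by simp_all
    have AX: "A * X \<in> carrier_mat n k" using assms(2) X by simp
    have "mat_adjoint X * A * X = mat_adjoint X * (A * X)" using adjX assms(2) X by simp
    then have "(mat_adjoint X * A * X) $$ (i, j) = (\<Sum>l<n. mat_adjoint X $$ (i, l) * (A * X) $$ (l, j))"
      using index_mult_mat_sum[OF adjX AX ij] by simp
    also have "\<dots> = (\<Sum>l<n. mat_adjoint X $$ (i, l) * (\<Sum>m<n. A $$ (l, m) * X $$ (m, j)))"
      using index_mult_mat_sum[OF assms(2) X _ ij(2)] by simp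
    also have "\<dots> = a (us i) (us j) / (s i * s j)"
      using ij by (simp add: a_def adj X_entry sum_divide_distrib sum_distrib_left mult.assoc)
    also have "\<dots> = \<mu> * (ip (us i) (us j) / (s i * s j))" using U(6) usU ij by simp
    finally show "(mat_adjoint X * A * X) $$ (i, j) = (\<mu> \<cdot>\<^sub>m 1\<^sub>m k) $$ (i, j)" using gram[OF ij] ij by simp
  qed (use X adjX in auto)
  ultimately have "\<mu> \<in> rank_numerical_range k A"
    unfolding rank_numerical_range_def using X assms(2) by auto
  then show ?thesis by blast
qed

end
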